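(* For every outerplanar graph $G$, we have $\overrightarrow{\chi}_s(G)\le 4$, and this bound is tight, i.e., there exists an outerplanar graph $G$ with $\overrightarrow{\chi}_s(G)=4$.
   Context: All graphs are finite and simple. An outerplanar graph is a graph having a planar embedding in which all vertices lie on the boundary of the outer face. An orientation $D$ of a graph $G$ is a digraph obtained from $G$ by replacing each edge by exactly one of the two possible arcs with the same end-vertices; $A(D)$ denotes its arc set. Given an orientation $D$ of $G$ and a weight function $w\colon A(D)\to\mathbb{Z}_+$ (values are positive integers), the in-weight $w^-_D(v)$ of a vertex $v$ is the sum of the weights of the arcs directed towards $v$ (so it is $0$ if there are none). The pair $(D,w)$ is a semi-proper orientation of $G$ if $w^-_D(u)\neq w^-_D(v)$ for every edge $uv\in E(G)$. Let $\mu^-(D,w)=\max_{v\in V(G)}w^-_D(v)$. The semi-proper orientation number $\overrightarrow{\chi}_s(G)$ is the minimum of $\mu^-(D,w)$ over all semi-proper orientations $(D,w)$ of $G$. *)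

theory Defs
  imports "HOL-Analysis.Analysis" "Graph_Theory.Pair_Digraph"
begin

text \<open>
  A finite simple graph is a \<^locale>\<open>pair_graph\<close>: a finite loop-free symmetric digraph without
  parallel arcs, in which an edge uv is the pair of opposite arcs (u,v) and (v,u).
\<close>

text \<open>
  Both arcs of an edge are drawn as the same Jordan arc, traversed in opposite directions.
\<close>

definition planar_embedding ::
  "'a pair_pre_digraph \<Rightarrow> ('a \<Rightarrow> complex) \<Rightarrow> ('a \<times> 'a \<Rightarrow> real \<Rightarrow> complex) \<Rightarrow> bool" where
  "planar_embedding G pos \<gamma> \<longleftrightarrow>
     inj_on pos (pverts G) \<and>
     (\<forall>(u, v) \<in> parcs G.
        arc (\<gamma> (u, v)) \<and> pathstart (\<gamma> (u, v)) = pos u \<and> pathfinish (\<gamma> (u, v)) = pos v \<and>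
        \<gamma> (v, u) = reversepath (\<gamma> (u, v)) \<and>
        path_image (\<gamma> (u, v)) \<inter> pos ` pverts G = {pos u, pos v}) \<and>
     (\<forall>(u, v) \<in> parcs G. \<forall>(x, y) \<in> parcs G. {u, v} \<noteq> {x, y} \<longrightarrow>
        path_image (\<gamma> (u, v)) \<inter> path_image (\<gamma> (x, y)) \<subseteq> pos ` ({u, v} \<inter> {x, y}))"

definition drawing ::
  "'a pair_pre_digraph \<Rightarrow> ('a \<Rightarrow> complex) \<Rightarrow> ('a \<times> 'a \<Rightarrow> real \<Rightarrow> complex) \<Rightarrow> complex set" where
  "drawing G pos \<gamma> = pos ` pverts G \<union> (\<Union>e \<in> parcs G. path_image (\<gamma> e))"

text \<open>
  The drawing of a finite graph is compact, so its \<^const>\<open>outside\<close> is the unique unbounded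
  component of the complement, i.e. the outer face.
\<close>

definition outerplanar :: "'a pair_pre_digraph \<Rightarrow> bool" where
  "outerplanar G \<longleftrightarrow>
     (\<exists>pos \<gamma>. planar_embedding G pos \<gamma> \<and>
        pos ` pverts G \<subseteq> frontier (outside (drawing G pos \<gamma>)))"

definition orientation :: "'a pair_pre_digraph \<Rightarrow> 'a pair_pre_digraph \<Rightarrow> bool" where
  "orientation G D \<longleftrightarrow>
     pverts D = pverts G \<and> parcs D \<subseteq> parcs G \<and>
     (\<forall>(u, v) \<in> parcs G. (u, v) \<in> parcs D \<longleftrightarrow> (v, u) \<notin> parcs D)"

definition in_weight :: "'a pair_pre_digraph \<Rightarrow> ('a \<times> 'a \<Rightarrow> nat) \<Rightarrow> 'a \<Rightarrow> nat" where
  "in_weight D w v = (\<Sum>e \<in> in_arcs (with_proj D) v. w e)"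

definition semi_proper_orientation ::
  "'a pair_pre_digraph \<Rightarrow> 'a pair_pre_digraph \<Rightarrow> ('a \<times> 'a \<Rightarrow> nat) \<Rightarrow> bool" where
  "semi_proper_orientation G D w \<longleftrightarrow>
     orientation G D \<and> (\<forall>e \<in> parcs D. 0 < w e) \<and>
     (\<forall>(u, v) \<in> parcs G. in_weight D w u \<noteq> in_weight D w v)"

text \<open>
  On a nonempty finite set of naturals the supremum is the maximum; on the empty set it is 0,
  which is the value given to the graph without vertices.
\<close>

definition max_in_weight :: "'a pair_pre_digraph \<Rightarrow> ('a \<times> 'a \<Rightarrow> nat) \<Rightarrow> nat" where
  "max_in_weight D w = (SUP v \<in> pverts D. in_weight D w v)"

definition semi_proper_orientation_number :: "'a pair_pre_digraph \<Rightarrow> nat" where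
  "semi_proper_orientation_number G =
     (LEAST k. \<exists>D w. semi_proper_orientation G D w \<and> max_in_weight D w = k)"

end

theory Submission
  imports Defs
begin

text \<open>
  Upper bound: in an outerplanar graph every nonempty set of vertices contains a vertex with at most
  two neighbours in that set, so the vertices can be inserted one by one with at most two earlier
  neighbours each. Orient edges from earlier to later. A vertex without earlier neighbours has
  in-weight 0; any other one gets an in-weight in {2, 3, 4} that avoids those of its at most two
  earlier neighbours. To find the vertex, rotate a longest path: minimum degree 3 would force a
  \<open>K\<^sub>4\<close> or three internally disjoint paths of length at least two with common ends, and neither
  can be drawn with all vertices on the outer face.

  Tightness: start from an edge, glue a triangle onto it, then one onto each of the two new edges, and
  so on, five times.
  Suppose that all in-weights are at most 3. For an edge with everything glued onto it, count the arcs
  that enter its two ends from the glued part; a triangle with apex \<open>m\<close> contributes two more arcs than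
  its two outer edges pass on, at most the in-weight of \<open>m\<close> of which enter \<open>m\<close>. Hence the count
  is forced up with the depth until it exceeds the sum of the in-weights of the ends.
\<close>

section \<open>Theta curves and crossing chords in the plane\<close>

text \<open>Running along \<open>c1\<close> and back along \<open>c2\<close> gives a simple closed
  path, so the Jordan curve theorem applies to its image \<open>J\<close>.\<close>

lemma Jordan_two_arcs:
  fixes c1 c2 :: "real \<Rightarrow> complex"
  assumes "arc c1" "arc c2"
    and "pathstart c1 = a" "pathfinish c1 = b" "pathstart c2 = a" "pathfinish c2 = b"
    and "path_image c1 \<inter> path_image c2 = {a, b}"
  defines "J \<equiv> path_image c1 \<union> path_image c2"
  shows "compact J" "inside J \<noteq> {}" "open (inside J)" "connected (inside J)" "bounded (inside J)"
    and "open (outside J)" "connected (outside J)" "\<not> bounded (outside J)"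
    and "frontier (inside J) = J"
proof -
  have "simple_path (c1 +++ reversepath c2)"
    using assms by (intro simple_path_join_loop) (auto simp: arc_reversepath)
  moreover have "pathfinish (c1 +++ reversepath c2) = pathstart (c1 +++ reversepath c2)"
    using assms by simp
  moreover have "path_image (c1 +++ reversepath c2) = J"
    using assms by (simp add: path_image_join)
  ultimately show "inside J \<noteq> {}" "open (inside J)" "connected (inside J)" "bounded (inside J)"
    and "open (outside J)" "connected (outside J)" "\<not> bounded (outside J)"
    and "frontier (inside J) = J"
    using Jordan_inside_outside by metis+
  show "compact J"
    using assms by (simp add: J_def compact_arc_image compact_Un)
qed

lemma connected_subset_inside_or_outside:
  assumes "connected C" "C \<inter> J = {}" "open (inside J)" "open (outside J)"
  shows "C \<subseteq> inside J \<or> C \<subseteq> outside J"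
  using connectedD[of C "inside J" "outside J"] assms inside_Un_outside[of J]
    inside_Int_outside[of J] by blast

text \<open>
  If no arc of a theta curve ran inside the circle of the other two, then a point inside the circle
  of the second and third arc and a point far away would be separated neither by the circle of the
  first and second arc nor by that of the first and third, whose intersection is connected; this
  contradicts Janiszewski's theorem.
\<close>

lemma theta_curve_inside:
  fixes c1 c2 c3 :: "real \<Rightarrow> complex"
  assumes arcs: "arc c1" "arc c2" "arc c3"
    and ends: "pathstart c1 = a" "pathfinish c1 = b" "pathstart c2 = a" "pathfinish c2 = b"
      "pathstart c3 = a" "pathfinish c3 = b"
    and disj: "path_image c1 \<inter> path_image c2 = {a, b}" "path_image c1 \<inter> path_image c3 = {a, b}"
      "path_image c2 \<inter> path_image c3 = {a, b}"
    and p1: "p \<in> path_image c1" "p \<notin> {a, b}" "p \<notin> inside (path_image c2 \<union> path_image c3)"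
    and p2: "q \<in> path_image c2" "q \<notin> {a, b}" "q \<notin> inside (path_image c1 \<union> path_image c3)"
  shows "path_image c3 - {a, b} \<subseteq> inside (path_image c1 \<union> path_image c2)"
proof (rule ccontr)
  let ?J12 = "path_image c1 \<union> path_image c2" and ?J13 = "path_image c1 \<union> path_image c3"
    and ?J23 = "path_image c2 \<union> path_image c3"
  assume neg: "\<not> path_image c3 - {a, b} \<subseteq> inside ?J12"
  note J12 = Jordan_two_arcs[OF arcs(1,2) ends(1-4) disj(1)]
  note J13 = Jordan_two_arcs[OF arcs(1,3) ends(1,2,5,6) disj(2)]
  note J23 = Jordan_two_arcs[OF arcs(2,3) ends(3-6) disj(3)]
  have conn: "connected (path_image c - {a, b})" if "arc c" "pathstart c = a" "pathfinish c = b" for c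
    using connected_simple_path_endless[OF arc_imp_simple_path[OF that(1)]] that by simp
  \<comment> \<open>An arc without its ends is still connected, so the single point \<open>p\<close>
    decides on which side of the curve \<open>?J23\<close> it runs.\<close>
  have out1: "path_image c1 - {a, b} \<subseteq> outside ?J23"
    using connected_subset_inside_or_outside[OF conn[OF arcs(1) ends(1,2)], of ?J23] p1 disj J23 by blast
  have out2: "path_image c2 - {a, b} \<subseteq> outside ?J13"
    using connected_subset_inside_or_outside[OF conn[OF arcs(2) ends(3,4)], of ?J13] p2 disj J13 by blast
  have out3: "path_image c3 - {a, b} \<subseteq> outside ?J12"
    using connected_subset_inside_or_outside[OF conn[OF arcs(3) ends(5,6)], of ?J12] neg disj J12 by blast
  have ab: "{a, b} \<subseteq> ?J23" using disj by blast
  have in1: "inside ?J23 \<inter> path_image c1 = {}"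
    using out1 ab inside_Int_outside[of ?J23] inside_no_overlap[of ?J23] by blast
  have cl: "?J23 \<subseteq> closure (inside ?J23)"
    using J23(9) by (auto simp: frontier_def)
  have "\<exists>q. q \<in> path_image c3 - {a, b}"
    by (metis arcs(3) ends(5,6) arc_simple_path nonempty_simple_path_endless ex_in_conv)
  then obtain p3 where p3: "p3 \<in> path_image c3" "p3 \<notin> {a, b}" by blast
  \<comment> \<open>A point of the third arc lies in the open set \<open>outside ?J12\<close> and on
    the boundary of \<open>inside ?J23\<close>, so the two regions meet. Since
    \<open>inside ?J23\<close> is connected and misses \<open>?J12\<close>, it cannot leave
    \<open>outside ?J12\<close>.\<close>
  have sub12: "inside ?J23 \<subseteq> outside ?J12"
  proof -
    have "outside ?J12 \<inter> closure (inside ?J23) \<noteq> {}"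
      using p3 out3 cl by blast
    then have "outside ?J12 \<inter> inside ?J23 \<noteq> {}"
      using J12(6) open_Int_closure_eq_empty by blast
    moreover have "inside ?J23 \<inter> ?J12 = {}"
      using in1 inside_no_overlap[of ?J23] by blast
    ultimately show ?thesis
      using connected_subset_inside_or_outside[OF J23(4) _ J12(3,6)] inside_Int_outside[of ?J12] by blast
  qed
  have sub13: "inside ?J23 \<subseteq> outside ?J13"
  proof -
    have "outside ?J13 \<inter> closure (inside ?J23) \<noteq> {}"
      using p2 out2 cl by blast
    then have "outside ?J13 \<inter> inside ?J23 \<noteq> {}"
      using J13(6) open_Int_closure_eq_empty by blast
    moreover have "inside ?J23 \<inter> ?J13 = {}"
      using in1 inside_no_overlap[of ?J23] by blast
    ultimately show ?thesis
      using connected_subset_inside_or_outside[OF J23(4) _ J13(3,6)] inside_Int_outside[of ?J13] by blast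
  qed
  obtain x where x: "x \<in> inside ?J23" using J23(2) by blast
  have "bounded (?J12 \<union> ?J13)"
    using J12(1) J13(1) compact_imp_bounded by blast
  then have unb: "\<not> bounded (outside (?J12 \<union> ?J13))"
    by (rule unbounded_outside)
  then obtain y where y: "y \<in> outside (?J12 \<union> ?J13)"
    by (metis bounded_empty ex_in_conv)
  have y': "y \<in> outside ?J12" "y \<in> outside ?J13" "y \<in> outside ?J23"
    using y outside_mono[of _ "?J12 \<union> ?J13"] by blast+
  have "connected_component (- ?J12) x y"
    using x y' sub12 J12(7) outside_no_overlap[of ?J12] unfolding connected_component_def by blast
  moreover have "connected_component (- ?J13) x y"
    using x y' sub13 J13(7) outside_no_overlap[of ?J13] unfolding connected_component_def by blast
  moreover have "?J12 \<inter> ?J13 = path_image c1" using disj by blast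
  ultimately have "connected_component (- (?J12 \<union> ?J13)) x y"
    using Janiszewski[OF J12(1) compact_imp_closed[OF J13(1)]] connected_arc_image[OF arcs(1)] by simp
  then have "connected_component (- ?J23) x y"
    by (rule connected_component_of_subset) blast
  then have "y \<in> inside ?J23"
    using x inside_same_component by blast
  then show False
    using y'(3) inside_Int_outside[of ?J23] by blast
qed

lemma ends_in_closure_arc:
  assumes "path g"
  shows "{pathstart g, pathfinish g} \<subseteq> closure (g ` {0<..<1})"
proof -
  have "continuous_on (closure {0<..<1::real}) g"
    using assms by (simp add: path_def)
  from image_closure_subset[OF this closed_closure closure_subset]
  show ?thesis by (auto simp: pathstart_def pathfinish_def)
qed

text \<open>The same circle is read as a pair of arcs from \<open>a\<close> to \<open>c\<close> and
  as a pair from \<open>b\<close> to \<open>d\<close>, so \<open>theta_curve_inside\<close> puts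
  both \<open>e\<close> and \<open>f\<close> inside it. There \<open>e\<close> separates two
  regions, and \<open>f\<close>, which avoids \<open>e\<close>, stays in one of them. Then both ends
  of \<open>f\<close> are in the closure of that region, but one of them lies on the opposite arc of
  the circle.\<close>

lemma no_crossing_chords:
  fixes c1 c2 d1 d2 e f :: "real \<Rightarrow> complex"
  assumes arcs: "arc c1" "arc c2" "arc e" "arc d1" "arc d2" "arc f"
    and ends: "pathstart c1 = a" "pathfinish c1 = c" "pathstart c2 = a" "pathfinish c2 = c"
      "pathstart e = a" "pathfinish e = c"
      "pathstart d1 = b" "pathfinish d1 = d" "pathstart d2 = b" "pathfinish d2 = d"
      "pathstart f = b" "pathfinish f = d"
    and disj: "path_image c1 \<inter> path_image c2 = {a, c}" "path_image c1 \<inter> path_image e = {a, c}"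
      "path_image c2 \<inter> path_image e = {a, c}"
      "path_image d1 \<inter> path_image d2 = {b, d}" "path_image d1 \<inter> path_image f = {b, d}"
      "path_image d2 \<inter> path_image f = {b, d}"
    and circ: "path_image c1 \<union> path_image c2 = path_image d1 \<union> path_image d2"
    and ef: "path_image e \<inter> path_image f = {}"
    and b: "b \<in> path_image c1" "b \<notin> inside (path_image c2 \<union> path_image e)"
    and d: "d \<in> path_image c2" "d \<notin> inside (path_image c1 \<union> path_image e)"
    and a: "a \<in> path_image d1" "a \<notin> inside (path_image d2 \<union> path_image f)"
    and c: "c \<in> path_image d2" "c \<notin> inside (path_image d1 \<union> path_image f)"
    and dist: "distinct [a, b, c, d]"
  shows False
proof -
  have e: "path_image e - {a, c} \<subseteq> inside (path_image c1 \<union> path_image c2)"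
    by (rule theta_curve_inside[OF arcs(1-3) ends(1-6) disj(1-3) b(1) _ b(2) d(1) _ d(2)]) (use dist in auto)
  have f: "path_image f - {b, d} \<subseteq> inside (path_image c1 \<union> path_image c2)"
    unfolding circ
    by (rule theta_curve_inside[OF arcs(4-6) ends(7-12) disj(4-6) a(1) _ a(2) c(1) _ c(2)]) (use dist in auto)
  have ne: "path_image e - {a, c} \<noteq> {}"
    using nonempty_simple_path_endless[OF arc_imp_simple_path[OF arcs(3)]] ends by simp
  let ?I1 = "inside (path_image c1 \<union> path_image e)" and ?I2 = "inside (path_image c2 \<union> path_image e)"
  have "path_image e \<inter> inside (path_image c1 \<union> path_image c2) \<noteq> {}"
    using ne e by blast
  then obtain sp: "?I1 \<inter> ?I2 = {}"
    "?I1 \<union> ?I2 \<union> (path_image e - {a, c}) = inside (path_image c1 \<union> path_image c2)"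
    using split_inside_simple_closed_curve[OF arc_imp_simple_path[OF arcs(1)] ends(1,2)
        arc_imp_simple_path[OF arcs(2)] ends(3,4) arc_imp_simple_path[OF arcs(3)] ends(5,6) _ disj(1-3)]
      dist by auto
  have op: "open ?I1" "open ?I2"
    using Jordan_two_arcs(3)[OF arcs(1,3) ends(1,2,5,6) disj(2)]
      Jordan_two_arcs(3)[OF arcs(2,3) ends(3-6) disj(3)] by auto
  have cf: "connected (path_image f - {b, d})"
    using connected_simple_path_endless[OF arc_imp_simple_path[OF arcs(6)]] ends by simp
  have clf: "{b, d} \<subseteq> closure (path_image f - {b, d})"
    using ends_in_closure_arc[OF arc_imp_path[OF arcs(6)]]
      simple_path_endless[OF arc_imp_simple_path[OF arcs(6)]] ends by simp
  have "path_image f - {b, d} \<subseteq> ?I1 \<union> ?I2"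
    using f sp ef by blast
  then have "path_image f - {b, d} \<subseteq> ?I1 \<or> path_image f - {b, d} \<subseteq> ?I2"
    using connectedD[OF cf op] sp(1) by blast
  then show False
  proof
    assume "path_image f - {b, d} \<subseteq> ?I1"
    then have "d \<in> closure ?I1" using clf closure_mono by blast
    moreover have "closure ?I1 \<subseteq> ?I1 \<union> (path_image c1 \<union> path_image e)"
      using Jordan_two_arcs(9)[OF arcs(1,3) ends(1,2,5,6) disj(2)] closure_Un_frontier by blast
    moreover have "d \<notin> path_image c1" "d \<notin> path_image e"
      using d(1) disj dist by auto
    ultimately show False using d(2) by blast
  next
    assume "path_image f - {b, d} \<subseteq> ?I2"
    then have "b \<in> closure ?I2" using clf closure_mono by blast
    moreover have "closure ?I2 \<subseteq> ?I2 \<union> (path_image c2 \<union> path_image e)"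
      using Jordan_two_arcs(9)[OF arcs(2,3) ends(3-6) disj(3)] closure_Un_frontier by blast
    moreover have "b \<notin> path_image c2" "b \<notin> path_image e"
      using b(1) disj dist by auto
    ultimately show False using b(2) by blast
  qed
qed

section \<open>Paths in plane graphs\<close>

lemma pair_graphD:
  assumes "pair_graph G" "(u, v) \<in> parcs G"
  shows "u \<in> pverts G" "v \<in> pverts G" "u \<noteq> v" "(v, u) \<in> parcs G"
proof -
  interpret pair_graph G by (rule assms(1))
  show "u \<in> pverts G" "v \<in> pverts G"
    using assms(2) in_arcsD1 in_arcsD2 by blast+
  show "u \<noteq> v"
    using assms(2) pair_no_loops by fastforce
  show "(v, u) \<in> parcs G"
    using assms(2) pair_sym_arcs by (auto simp: symmetric_def dest: symD)
qed

lemma pair_graph_finite_verts: "pair_graph G \<Longrightarrow> finite (pverts G)"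
  by (simp add: pair_graph_def pair_digraph_def pair_fin_digraph.pair_finite_verts)

text \<open>Based on a bare edge set, so that plane graphs and the purely combinatorial argument
  about longest paths share one notion.\<close>

definition simple_path_list :: "('a \<times> 'a) set \<Rightarrow> 'a list \<Rightarrow> bool" where
  "simple_path_list E p \<longleftrightarrow> distinct p \<and> successively (\<lambda>u v. (u, v) \<in> E) p"

definition path_list_edges :: "'a list \<Rightarrow> ('a \<times> 'a) set" where
  "path_list_edges p = set (zip p (tl p))"

lemma path_list_edges_simps [simp]:
  "path_list_edges [] = {}" "path_list_edges [u] = {}"
  "path_list_edges (u # v # p) = insert (u, v) (path_list_edges (v # p))"
  by (auto simp: path_list_edges_def)

lemma path_list_edges_subset: "path_list_edges p \<subseteq> set p \<times> set p"
  by (induction p rule: induct_list012) auto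

lemma simple_path_list_edges: "simple_path_list E p \<Longrightarrow> path_list_edges p \<subseteq> E"
  by (induction p rule: induct_list012) (auto simp: simple_path_list_def)

definition path_list_image :: "('a \<times> 'a \<Rightarrow> real \<Rightarrow> complex) \<Rightarrow> 'a list \<Rightarrow> complex set" where
  "path_list_image \<gamma> p = (\<Union>e \<in> path_list_edges p. path_image (\<gamma> e))"

text \<open>No edge of the path enters \<open>a\<close>, which excludes \<open>(b, a)\<close>; and
  the only edge leaving \<open>a\<close> goes to the first vertex of \<open>xs\<close> if there is
  one, which excludes \<open>(a, b)\<close>.\<close>

lemma end_edge_path_list:
  assumes "distinct (a # xs @ [b])" "{u, v} = {a, b}" "(u, v) \<in> path_list_edges (a # xs @ [b])"
  shows "xs = []"
proof (cases xs)
  case (Cons x ys)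
  have "a \<notin> snd ` path_list_edges (a # xs @ [b])"
    using assms(1) by (auto simp: path_list_edges_def dest: set_zip_rightD)
  moreover have "(a, b) \<notin> path_list_edges (a # xs @ [b])"
    using assms(1) path_list_edges_subset[of "x # ys @ [b]"] Cons by auto
  ultimately show ?thesis
    using assms(2,3) by (auto simp: doubleton_eq_iff image_iff)
qed

context
  fixes G :: "'a pair_pre_digraph" and pos \<gamma>
  assumes G: "pair_graph G" and emb: "planar_embedding G pos \<gamma>"
begin

lemma edge_arc:
  assumes "(u, v) \<in> parcs G"
  shows "arc (\<gamma> (u, v))" "pathstart (\<gamma> (u, v)) = pos u" "pathfinish (\<gamma> (u, v)) = pos v"
    "path_image (\<gamma> (u, v)) \<inter> pos ` pverts G = {pos u, pos v}"
  using emb assms unfolding planar_embedding_def by blast+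

lemma edges_inter:
  assumes "(u, v) \<in> parcs G" "(x, y) \<in> parcs G" "{u, v} \<noteq> {x, y}"
  shows "path_image (\<gamma> (u, v)) \<inter> path_image (\<gamma> (x, y)) \<subseteq> pos ` ({u, v} \<inter> {x, y})"
  using emb assms unfolding planar_embedding_def by blast

lemma path_list_images_inter:
  assumes "simple_path_list (parcs G) p" "simple_path_list (parcs G) q"
    and "\<And>u v x y. (u, v) \<in> path_list_edges p \<Longrightarrow> (x, y) \<in> path_list_edges q \<Longrightarrow> {u, v} \<noteq> {x, y}"
  shows "path_list_image \<gamma> p \<inter> path_list_image \<gamma> q \<subseteq> pos ` (set p \<inter> set q)"
proof
  fix z assume "z \<in> path_list_image \<gamma> p \<inter> path_list_image \<gamma> q"
  then obtain u v x y where *: "(u, v) \<in> path_list_edges p" "(x, y) \<in> path_list_edges q"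
    "z \<in> path_image (\<gamma> (u, v))" "z \<in> path_image (\<gamma> (x, y))"
    unfolding path_list_image_def by force
  then have "z \<in> pos ` ({u, v} \<inter> {x, y})"
    using edges_inter[of u v x y] assms simple_path_list_edges by blast
  then show "z \<in> pos ` (set p \<inter> set q)"
    using * path_list_edges_subset by blast
qed

text \<open>The edges are joined one after the other. Two leading vertices are required because a
  path with a single vertex has no edge and yields no arc.\<close>

lemma path_list_arc:
  assumes "simple_path_list (parcs G) (u # v # p)"
  shows "\<exists>g. arc g \<and> pathstart g = pos u \<and> pathfinish g = pos (last (v # p)) \<and>
    path_image g = path_list_image \<gamma> (u # v # p)"
  using assms
proof (induction p arbitrary: u v)
  case Nil
  then show ?case
    using edge_arc[of u v] by (auto simp: simple_path_list_def path_list_image_def)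
next
  case (Cons x p)
  have uv: "(u, v) \<in> parcs G" and sp: "simple_path_list (parcs G) (v # x # p)"
    and u: "u \<notin> set (v # x # p)"
    using Cons.prems by (auto simp: simple_path_list_def)
  obtain g where g: "arc g" "pathstart g = pos v" "pathfinish g = pos (last (x # p))"
    "path_image g = path_list_image \<gamma> (v # x # p)"
    using Cons.IH[OF sp] by blast
  have "path_list_image \<gamma> [u, v] \<inter> path_list_image \<gamma> (v # x # p) \<subseteq> pos ` (set [u, v] \<inter> set (v # x # p))"
    using uv sp u path_list_edges_subset[of "v # x # p"]
    by (intro path_list_images_inter) (auto simp: simple_path_list_def doubleton_eq_iff)
  then have "path_image (\<gamma> (u, v)) \<inter> path_image g \<subseteq> {pos v}"
    using u by (auto simp: path_list_image_def g(4))
  then have "arc (\<gamma> (u, v) +++ g)"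
    using edge_arc[OF uv] g by (intro arc_join) auto
  moreover have "path_image (\<gamma> (u, v) +++ g) = path_list_image \<gamma> (u # v # x # p)"
    using edge_arc[OF uv] g by (simp add: path_image_join path_list_image_def)
  ultimately show ?case
    using edge_arc[OF uv] g by (intro exI[of _ "\<gamma> (u, v) +++ g"]) auto
qed

lemma path_list_between_arc:
  assumes "simple_path_list (parcs G) (a # xs @ [b])"
  obtains g where "arc g" "pathstart g = pos a" "pathfinish g = pos b"
    "path_image g = path_list_image \<gamma> (a # xs @ [b])"
  using path_list_arc[of a "hd (xs @ [b])" "tl (xs @ [b])"] assms by auto

lemma pos_in_path_list_image:
  assumes "simple_path_list (parcs G) p" "x \<in> pverts G"
  shows "pos x \<in> path_list_image \<gamma> p \<longleftrightarrow> (\<exists>u v. (u, v) \<in> path_list_edges p \<and> x \<in> {u, v})"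
proof
  assume "pos x \<in> path_list_image \<gamma> p"
  then obtain u v where uv: "(u, v) \<in> path_list_edges p" "pos x \<in> path_image (\<gamma> (u, v))"
    unfolding path_list_image_def by force
  then have E: "(u, v) \<in> parcs G" using assms simple_path_list_edges by blast
  then have "pos x \<in> {pos u, pos v}"
    using edge_arc(4)[OF E] uv assms by blast
  moreover have "inj_on pos (pverts G)" using emb by (simp add: planar_embedding_def)
  ultimately have "x \<in> {u, v}"
    using assms(2) pair_graphD(1,2)[OF G E] by (auto dest: inj_onD)
  then show "\<exists>u v. (u, v) \<in> path_list_edges p \<and> x \<in> {u, v}" using uv by blast
next
  assume "\<exists>u v. (u, v) \<in> path_list_edges p \<and> x \<in> {u, v}"
  then obtain u v where uv: "(u, v) \<in> path_list_edges p" "x \<in> {u, v}" by blast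
  then have "(u, v) \<in> parcs G" using assms simple_path_list_edges by blast
  then have "pos x \<in> path_image (\<gamma> (u, v))" using edge_arc(4) uv by blast
  then show "pos x \<in> path_list_image \<gamma> p" using uv unfolding path_list_image_def by blast
qed

lemma pos_in_path_list_image_iff:
  assumes "simple_path_list (parcs G) (a # xs @ [b])" "x \<in> pverts G"
  shows "pos x \<in> path_list_image \<gamma> (a # xs @ [b]) \<longleftrightarrow> x \<in> set (a # xs @ [b])"
proof -
  have "\<exists>u v. (u, v) \<in> path_list_edges (a # xs @ [b]) \<and> x \<in> {u, v}" if "x \<in> set (a # xs @ [b])" for x
    using that
  proof (induction xs arbitrary: a)
    case (Cons y xs)
    show ?case
    proof (cases "x = a")
      case True
      then have "(a, y) \<in> path_list_edges (a # (y # xs) @ [b])" by simp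
      with True show ?thesis by blast
    next
      case False
      then obtain u v where "(u, v) \<in> path_list_edges (y # xs @ [b])" "x \<in> {u, v}"
        using Cons.IH[of y] Cons.prems by auto
      then show ?thesis by (intro exI[of _ u] exI[of _ v]) simp
    qed
  qed auto
  then show ?thesis
    unfolding pos_in_path_list_image[OF assms] using path_list_edges_subset by fastforce
qed

text \<open>A common edge would have to join \<open>a\<close> and \<open>b\<close>, and by
  \<open>end_edge_path_list\<close> it would be the whole first path. Only \<open>xs\<close> has to
  be nonempty, so the second path may be a chord.\<close>

lemma path_list_images_inter_ends:
  assumes p: "simple_path_list (parcs G) (a # xs @ [b])" "simple_path_list (parcs G) (a # ys @ [b])"
    and disj: "set xs \<inter> set ys = {}" "xs \<noteq> []"
  shows "path_list_image \<gamma> (a # xs @ [b]) \<inter> path_list_image \<gamma> (a # ys @ [b]) = {pos a, pos b}"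
proof
  have "path_list_image \<gamma> (a # xs @ [b]) \<inter> path_list_image \<gamma> (a # ys @ [b])
    \<subseteq> pos ` (set (a # xs @ [b]) \<inter> set (a # ys @ [b]))"
  proof (rule path_list_images_inter[OF p], rule notI)
    fix u v x y
    assume *: "(u, v) \<in> path_list_edges (a # xs @ [b])" "(x, y) \<in> path_list_edges (a # ys @ [b])"
      "{u, v} = {x, y}"
    have "{u, v} \<subseteq> set (a # xs @ [b])" "{x, y} \<subseteq> set (a # ys @ [b])"
      using *(1,2) path_list_edges_subset by fastforce+
    then have "{u, v} \<subseteq> {a, b}" using *(3) disj by auto
    moreover have "u \<noteq> v"
      using * simple_path_list_edges[OF p(1)] pair_graphD(3)[OF G] by blast
    ultimately have "{u, v} = {a, b}" by auto
    then show False
      using end_edge_path_list[OF _ _ *(1)] p disj by (auto simp: simple_path_list_def)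
  qed
  then show "path_list_image \<gamma> (a # xs @ [b]) \<inter> path_list_image \<gamma> (a # ys @ [b]) \<subseteq> {pos a, pos b}"
    using disj by auto
next
  have "pos a \<in> path_list_image \<gamma> (a # xs @ [b])" "pos b \<in> path_list_image \<gamma> (a # xs @ [b])"
    if "simple_path_list (parcs G) (a # xs @ [b])" for xs
    using path_list_between_arc[OF that] pathstart_in_path_image pathfinish_in_path_image by metis+
  then show "{pos a, pos b} \<subseteq> path_list_image \<gamma> (a # xs @ [b]) \<inter> path_list_image \<gamma> (a # ys @ [b])"
    using p by blast
qed

section \<open>Configurations excluded when all vertices lie on the outer face\<close>

context
  assumes out: "pos ` pverts G \<subseteq> frontier (outside (drawing G pos \<gamma>))"
begin

text \<open>Every neighbourhood of a vertex meets the outer face, and the outer face of the drawing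
  is contained in the outside of each closed curve \<open>J\<close> drawn in it.\<close>

lemma vertex_not_inside:
  assumes x: "x \<in> pverts G" and J: "J \<subseteq> drawing G pos \<gamma>" "closed J"
  shows "pos x \<notin> inside J"
proof
  assume "pos x \<in> inside J"
  moreover have "pos x \<in> closure (outside (drawing G pos \<gamma>))"
    using out x by (auto simp: frontier_def)
  ultimately have "inside J \<inter> outside (drawing G pos \<gamma>) \<noteq> {}"
    using open_inside[OF J(2)] open_Int_closure_eq_empty by blast
  then show False
    using outside_mono[OF J(1)] inside_Int_outside[of J] by blast
qed

lemma path_list_image_subset_drawing:
  assumes "simple_path_list (parcs G) p"
  shows "path_list_image \<gamma> p \<subseteq> drawing G pos \<gamma>"
  using simple_path_list_edges[OF assms] by (auto simp: path_list_image_def drawing_def)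

lemma closed_path_list_image:
  assumes "simple_path_list (parcs G) p"
  shows "closed (path_list_image \<gamma> p)"
proof -
  have "closed (path_image (\<gamma> e))" if "e \<in> path_list_edges p" for e
    using that simple_path_list_edges[OF assms] edge_arc(1) closed_arc_image by (cases e) blast
  then show ?thesis
    unfolding path_list_image_def by (intro closed_UN) (auto simp: path_list_edges_def)
qed

lemma vertex_not_inside_paths:
  assumes "x \<in> pverts G" "simple_path_list (parcs G) p" "simple_path_list (parcs G) q"
  shows "pos x \<notin> inside (path_list_image \<gamma> p \<union> path_list_image \<gamma> q)"
  using assms path_list_image_subset_drawing closed_path_list_image
  by (intro vertex_not_inside) auto

lemma path_list_in_pverts:
  assumes "simple_path_list (parcs G) (a # xs @ [b])" "x \<in> set (a # xs @ [b])"
  shows "x \<in> pverts G"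
proof -
  have "x \<in> pverts G" if "successively (\<lambda>u v. (u, v) \<in> parcs G) (a # xs @ [b])" "x \<in> set (a # xs @ [b])" for x
    using that
  proof (induction xs arbitrary: a)
    case (Cons y xs)
    then show ?case using pair_graphD(1)[OF G] by fastforce
  qed (use pair_graphD(1,2)[OF G] in auto)
  then show ?thesis using assms by (auto simp: simple_path_list_def)
qed

text \<open>By \<open>theta_curve_inside\<close> the third path would run inside the cycle of the
  other two, and so would its inner vertex \<open>z\<close>, contrary to
  \<open>vertex_not_inside\<close>.\<close>

lemma outerplanar_no_theta:
  assumes p: "simple_path_list (parcs G) (a # xs @ [b])" "simple_path_list (parcs G) (a # ys @ [b])"
    "simple_path_list (parcs G) (a # zs @ [b])"
    and ne: "xs \<noteq> []" "ys \<noteq> []" "zs \<noteq> []"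
    and disj: "set xs \<inter> set ys = {}" "set xs \<inter> set zs = {}" "set ys \<inter> set zs = {}"
  shows False
proof -
  obtain g1 where g1: "arc g1" "pathstart g1 = pos a" "pathfinish g1 = pos b"
      "path_image g1 = path_list_image \<gamma> (a # xs @ [b])"
    using path_list_between_arc[OF p(1)] by blast
  obtain g2 where g2: "arc g2" "pathstart g2 = pos a" "pathfinish g2 = pos b"
      "path_image g2 = path_list_image \<gamma> (a # ys @ [b])"
    using path_list_between_arc[OF p(2)] by blast
  obtain g3 where g3: "arc g3" "pathstart g3 = pos a" "pathfinish g3 = pos b"
      "path_image g3 = path_list_image \<gamma> (a # zs @ [b])"
    using path_list_between_arc[OF p(3)] by blast
  obtain x y z where x: "x \<in> set xs" and y: "y \<in> set ys" and z: "z \<in> set zs"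
    using ne by (meson list.set_sel(1))
  have inj: "inj_on pos (pverts G)" using emb by (simp add: planar_embedding_def)
  have V: "a \<in> pverts G" "b \<in> pverts G" "x \<in> pverts G" "y \<in> pverts G" "z \<in> pverts G"
    using path_list_in_pverts[OF p(1)] path_list_in_pverts[OF p(2)] path_list_in_pverts[OF p(3)] x y z
    by auto
  have neq: "pos w \<notin> {pos a, pos b}" if "w \<in> {x, y, z}" for w
    using that x y z p inj V by (auto simp: simple_path_list_def dest: inj_onD)
  have "path_image g3 - {pos a, pos b} \<subseteq> inside (path_image g1 \<union> path_image g2)"
  proof (rule theta_curve_inside[where p = "pos x" and q = "pos y"])
    show "pos x \<notin> inside (path_image g2 \<union> path_image g3)"
      "pos y \<notin> inside (path_image g1 \<union> path_image g3)"
      unfolding g1 g2 g3 using vertex_not_inside_paths V p by blast+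
    show "pos x \<in> path_image g1" "pos y \<in> path_image g2"
      unfolding g1 g2 using pos_in_path_list_image_iff p V x y by auto
    show "path_image g1 \<inter> path_image g2 = {pos a, pos b}"
      "path_image g1 \<inter> path_image g3 = {pos a, pos b}"
      "path_image g2 \<inter> path_image g3 = {pos a, pos b}"
      unfolding g1 g2 g3 using path_list_images_inter_ends p disj ne by blast+
  qed (use g1 g2 g3 neq in auto)
  moreover have "pos z \<in> path_image g3"
    unfolding g3 using pos_in_path_list_image_iff p V z by auto
  moreover have "pos z \<notin> inside (path_image g1 \<union> path_image g2)"
    unfolding g1 g2 using vertex_not_inside_paths V p by blast
  ultimately show False using neq by blast
qed

text \<open>The 4-cycle through \<open>a\<close>, \<open>b\<close>, \<open>c\<close>,
  \<open>d\<close> in this order is the circle, and the edges \<open>ac\<close> and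
  \<open>bd\<close> are its two crossing chords.\<close>

lemma outerplanar_no_K4:
  assumes dist: "distinct [a, b, c, d]"
    and E: "(a, b) \<in> parcs G" "(a, c) \<in> parcs G" "(a, d) \<in> parcs G"
      "(b, c) \<in> parcs G" "(b, d) \<in> parcs G" "(c, d) \<in> parcs G"
  shows False
proof -
  note sym = pair_graphD(4)[OF G]
  have p: "simple_path_list (parcs G) (a # [b] @ [c])" "simple_path_list (parcs G) (a # [d] @ [c])"
    "simple_path_list (parcs G) (a # [] @ [c])" "simple_path_list (parcs G) (b # [a] @ [d])" 
    "simple_path_list (parcs G) (b # [c] @ [d])" "simple_path_list (parcs G) (b # [] @ [d])"
    using dist E sym by (auto simp: simple_path_list_def)
  have V: "a \<in> pverts G" "b \<in> pverts G" "c \<in> pverts G" "d \<in> pverts G"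
    using E pair_graphD(1,2)[OF G] by blast+
  have inj: "inj_on pos (pverts G)" using emb by (simp add: planar_embedding_def)
  obtain c1 where c1: "arc c1" "pathstart c1 = pos a" "pathfinish c1 = pos c"
      "path_image c1 = path_list_image \<gamma> (a # [b] @ [c])"
    using path_list_between_arc[OF p(1)] by blast
  obtain c2 where c2: "arc c2" "pathstart c2 = pos a" "pathfinish c2 = pos c"
      "path_image c2 = path_list_image \<gamma> (a # [d] @ [c])"
    using path_list_between_arc[OF p(2)] by blast
  obtain e where e: "arc e" "pathstart e = pos a" "pathfinish e = pos c"
      "path_image e = path_list_image \<gamma> (a # [] @ [c])"
    using path_list_between_arc[OF p(3)] by blast
  obtain d1 where d1: "arc d1" "pathstart d1 = pos b" "pathfinish d1 = pos d"
      "path_image d1 = path_list_image \<gamma> (b # [a] @ [d])"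
    using path_list_between_arc[OF p(4)] by blast
  obtain d2 where d2: "arc d2" "pathstart d2 = pos b" "pathfinish d2 = pos d"
      "path_image d2 = path_list_image \<gamma> (b # [c] @ [d])"
    using path_list_between_arc[OF p(5)] by blast
  obtain f where f: "arc f" "pathstart f = pos b" "pathfinish f = pos d"
      "path_image f = path_list_image \<gamma> (b # [] @ [d])"
    using path_list_between_arc[OF p(6)] by blast
  \<comment> \<open>The two readings of the 4-cycle traverse \<open>ab\<close> and \<open>cd\<close>
    in opposite directions.\<close>
  have rev: "path_image (\<gamma> (v, u)) = path_image (\<gamma> (u, v))" if "(u, v) \<in> parcs G" for u v
    using emb that unfolding planar_embedding_def by fastforce
  show False
  proof (rule no_crossing_chords[OF c1(1) c2(1) e(1) d1(1) d2(1) f(1) c1(2,3) c2(2,3) e(2,3)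
      d1(2,3) d2(2,3) f(2,3)])
    show "path_image c1 \<inter> path_image c2 = {pos a, pos c}" "path_image c1 \<inter> path_image e = {pos a, pos c}"
      "path_image c2 \<inter> path_image e = {pos a, pos c}"
      unfolding c1 c2 e using dist by (intro path_list_images_inter_ends p; simp)+
    show "path_image d1 \<inter> path_image d2 = {pos b, pos d}" "path_image d1 \<inter> path_image f = {pos b, pos d}"
      "path_image d2 \<inter> path_image f = {pos b, pos d}"
      unfolding d1 d2 f using dist by (intro path_list_images_inter_ends p; simp)+
    show "path_image c1 \<union> path_image c2 = path_image d1 \<union> path_image d2"
      unfolding c1 c2 d1 d2 by (auto simp: path_list_image_def rev[OF E(1)] rev[OF E(6)])
    show "path_image e \<inter> path_image f = {}"
      unfolding e f using path_list_images_inter[OF p(3,6)] dist by (auto simp: doubleton_eq_iff)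
    show "pos b \<in> path_image c1" "pos d \<in> path_image c2" "pos a \<in> path_image d1" "pos c \<in> path_image d2"
      unfolding c1 c2 d1 d2 using pos_in_path_list_image_iff[OF p(1)] pos_in_path_list_image_iff[OF p(2)]
        pos_in_path_list_image_iff[OF p(4)] pos_in_path_list_image_iff[OF p(5)] V by auto
    show "pos b \<notin> inside (path_image c2 \<union> path_image e)" "pos d \<notin> inside (path_image c1 \<union> path_image e)"
      "pos a \<notin> inside (path_image d2 \<union> path_image f)" "pos c \<notin> inside (path_image d1 \<union> path_image f)"
      unfolding c1 c2 d1 d2 e f using vertex_not_inside_paths V p by blast+
    show "distinct [pos a, pos b, pos c, pos d]"
      using dist V by (auto simp: inj_on_eq_iff[OF inj])
  qed
qed

end
end

section \<open>Vertices of degree at most two\<close>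

context
  fixes E :: "('a \<times> 'a) set"
  assumes sym: "\<And>u v. (u, v) \<in> E \<Longrightarrow> (v, u) \<in> E" and irrefl: "\<And>u. (u, u) \<notin> E"
    and no_K4: "\<And>a b c d. distinct [a, b, c, d] \<Longrightarrow> (a, b) \<in> E \<Longrightarrow> (a, c) \<in> E \<Longrightarrow> (a, d) \<in> E \<Longrightarrow>
      (b, c) \<in> E \<Longrightarrow> (b, d) \<in> E \<Longrightarrow> (c, d) \<in> E \<Longrightarrow> False"
    and no_theta: "\<And>a b xs ys zs. simple_path_list E (a # xs @ [b]) \<Longrightarrow>
      simple_path_list E (a # ys @ [b]) \<Longrightarrow> simple_path_list E (a # zs @ [b]) \<Longrightarrow>
      xs \<noteq> [] \<Longrightarrow> ys \<noteq> [] \<Longrightarrow> zs \<noteq> [] \<Longrightarrow>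
      set xs \<inter> set ys = {} \<Longrightarrow> set xs \<inter> set zs = {} \<Longrightarrow> set ys \<inter> set zs = {} \<Longrightarrow> False"
begin

lemma successively_edges_rev:
  "successively (\<lambda>u v. (u, v) \<in> E) (rev p) \<longleftrightarrow> successively (\<lambda>u v. (u, v) \<in> E) p"
proof -
  have "(\<lambda>u v. (v, u) \<in> E) = (\<lambda>u v. (u, v) \<in> E)" using sym by blast
  from arg_cong[where f = "\<lambda>R. successively R p", OF this] show ?thesis
    by (simp only: successively_rev)
qed

text \<open>Rotation of a path: the chord from \<open>hd A\<close> to \<open>x\<close> replaces the
  edge from \<open>last A\<close> to \<open>x\<close>, so \<open>last A\<close> becomes the first
  vertex while the vertex set is kept.\<close>

lemma rotate_simple_path:
  assumes "simple_path_list E (A @ x # Q)" "A \<noteq> []" "(hd A, x) \<in> E"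
  shows "simple_path_list E (rev A @ x # Q)"
  using assms
  by (auto simp: simple_path_list_def successively_append_iff last_rev successively_edges_rev
      simp del: successively_rev)

text \<open>Three paths join \<open>last A\<close> to \<open>y\<close>: back through
  \<open>A\<close> and along the first chord; forward along the path through \<open>x\<close>; along
  the second chord to \<open>z\<close> and back along the path. The bound on the length of
  \<open>A\<close> gives the first one an inner vertex.\<close>

lemma no_crossing_path_chords:
  assumes p: "simple_path_list E (A @ x # Q1 @ y # Q2 @ z # Q3)" "length A \<ge> 2"
    and y: "(hd A, y) \<in> E" and z: "(last A, z) \<in> E"
  shows False
proof -
  obtain B l where "A = B @ [l]"
    using p(2) by (cases A rule: rev_cases) auto
  with p(2) have A: "A = B @ [l]" "B \<noteq> []" by auto
  let ?suc = "successively (\<lambda>u v. (u, v) \<in> E)"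
  have dist: "distinct (B @ l # x # Q1 @ y # Q2 @ z # Q3)"
    and suc: "?suc ((B @ [l]) @ x # Q1 @ y # Q2 @ z # Q3)"
    using p A by (simp_all add: simple_path_list_def)
  have B: "?suc (B @ [l])"
    using suc unfolding successively_append_iff by blast
  have "?suc (B @ (l # x # Q1 @ [y]) @ Q2 @ z # Q3)"
    using suc by simp
  then have Q1: "?suc (l # x # Q1 @ [y])"
    unfolding successively_append_iff[of _ B] successively_append_iff[of _ "l # x # Q1 @ [y]"] by blast
  have "?suc ((B @ l # x # Q1) @ (y # Q2 @ [z]) @ Q3)"
    using suc by simp
  then have "?suc (y # Q2 @ [z])"
    unfolding successively_append_iff[of _ "B @ l # x # Q1"] successively_append_iff[of _ "y # Q2 @ [z]"]
    by blast
  then have Q2: "?suc (z # rev Q2 @ [y])"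
    using successively_edges_rev[of "y # Q2 @ [z]"] by (simp del: successively_rev)
  have "?suc (rev (B @ [l]) @ [y])"
    unfolding successively_append_iff[of _ "rev (B @ [l])" "[y]"] successively_edges_rev
    using B y A by (auto simp: last_rev)
  then have "simple_path_list E (l # rev B @ [y])"
    using dist by (simp add: simple_path_list_def)
  moreover have "simple_path_list E (l # (x # Q1) @ [y])"
    using dist Q1 by (simp add: simple_path_list_def)
  moreover have "simple_path_list E (l # (z # rev Q2) @ [y])"
    using dist Q2 z A by (auto simp: simple_path_list_def)
  moreover have "set (rev B) \<inter> set (x # Q1) = {}" "set (rev B) \<inter> set (z # rev Q2) = {}"
    "set (x # Q1) \<inter> set (z # rev Q2) = {}"
    using dist by auto
  ultimately show False using no_theta[of l "rev B" y "x # Q1" "z # rev Q2"] A(2) by simp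
qed

text \<open>Both ends of \<open>A\<close> are adjacent to both \<open>x\<close> and
  \<open>y\<close>. Vertices between \<open>x\<close> and \<open>y\<close> give a theta with ends
  \<open>x\<close>, \<open>y\<close>; inner vertices of \<open>A\<close> give one whose ends are
  those of \<open>A\<close>; if neither exist, the four vertices form a \<open>K4\<close>.\<close>

lemma no_parallel_path_chords:
  assumes p: "simple_path_list E (A @ x # Q1 @ y # Q2)" "length A \<ge> 2"
    and x: "(hd A, x) \<in> E" and y: "(hd A, y) \<in> E" "(last A, y) \<in> E"
  shows False
proof -
  let ?suc = "successively (\<lambda>u v. (u, v) \<in> E)"
  obtain h C l where A: "A = h # C @ [l]"
    using p(2) by (cases A; cases "tl A" rule: rev_cases) auto
  have dist: "distinct (h # C @ l # x # Q1 @ y # Q2)"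
    and suc: "?suc ((h # C @ [l]) @ x # Q1 @ y # Q2)"
    using p A by (simp_all add: simple_path_list_def)
  have C: "?suc (h # C @ [l])" and lx: "(l, x) \<in> E"
    using suc unfolding successively_append_iff by auto
  have "?suc ((h # C @ [l]) @ (x # Q1 @ [y]) @ Q2)"
    using suc by simp
  then have Q1: "?suc (x # Q1 @ [y])"
    unfolding successively_append_iff[of _ "h # C @ [l]"] successively_append_iff[of _ "x # Q1 @ [y]"]
    by blast
  have edges: "(h, x) \<in> E" "(h, y) \<in> E" "(l, y) \<in> E"
    using x y A by auto
  note edges = edges lx edges[THEN sym] lx[THEN sym]
  show False
  proof (cases "Q1 = []")
    case False
    have "simple_path_list E (x # Q1 @ [y])" "simple_path_list E (x # [h] @ [y])"
      "simple_path_list E (x # [l] @ [y])"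
      using dist Q1 edges by (auto simp: simple_path_list_def)
    then show False
      using no_theta[of x "[h]" y "[l]" Q1] dist False by auto
  next
    case Q1_Nil: True
    show False
    proof (cases "C = []")
      case False
      have "simple_path_list E (h # C @ [l])" "simple_path_list E (h # [x] @ [l])"
        "simple_path_list E (h # [y] @ [l])"
        using dist C edges by (auto simp: simple_path_list_def)
      then show False
        using no_theta[of h "[x]" l "[y]" C] dist False by auto
    next
      case True
      then have "(h, l) \<in> E" "(x, y) \<in> E"
        using C Q1 Q1_Nil by auto
      then show False
        using no_K4[of h l x y] dist edges by auto
    qed
  qed
qed

text \<open>Otherwise every vertex of \<open>S\<close> has three neighbours in \<open>S\<close>, and
  those of the first vertex of a longest path all lie on it. Choose a longest path and a chord from
  its first vertex that cuts off as short an initial segment \<open>A\<close> as possible. The ends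
  of \<open>A\<close> then have neighbours \<open>y\<close> and \<open>z\<close> beyond
  \<open>x\<close>, the one for \<open>last A\<close> being found after a rotation, and the order of
  \<open>y\<close> and \<open>z\<close> decides which configuration appears.\<close>

lemma exists_degree_le_2:
  assumes S: "finite S" "S \<noteq> {}"
  shows "\<exists>v \<in> S. card {u \<in> S. (v, u) \<in> E} \<le> 2"
proof (rule ccontr)
  assume neg: "\<not> ?thesis"
  define path_in where "path_in p \<longleftrightarrow> simple_path_list E p \<and> set p \<subseteq> S \<and> p \<noteq> []" for p
  obtain s where "s \<in> S" using S by blast
  then have "path_in [s]" by (simp add: path_in_def simple_path_list_def)
  moreover have "\<forall>p. path_in p \<longrightarrow> length p < Suc (card S)"
    unfolding path_in_def simple_path_list_def using distinct_card S
    by (metis card_mono less_Suc_eq_le)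
  ultimately obtain p0 where p0: "path_in p0" "\<And>q. path_in q \<Longrightarrow> length q \<le> length p0"
    using ex_has_greatest_nat[of path_in "[s]" length] by blast
  define longest where "longest p \<longleftrightarrow> path_in p \<and> length p = length p0" for p
  have nbrs: "u \<in> set p" if "longest p" "u \<in> S" "(hd p, u) \<in> E" for p u
  proof (rule ccontr)
    assume "u \<notin> set p"
    then have "path_in (u # p)"
      using that sym[OF that(3)] by (auto simp: longest_def path_in_def simple_path_list_def successively_Cons)
    from p0(2)[OF this] show False using that by (simp add: longest_def)
  qed
  have third: "\<exists>y. y \<in> S \<and> (v, y) \<in> E \<and> y \<noteq> a \<and> y \<noteq> b" if "v \<in> S" for v a b
  proof (rule ccontr)
    assume "\<not> ?thesis"
    then have "card {u \<in> S. (v, u) \<in> E} \<le> card {a, b}" by (intro card_mono) auto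
    also have "\<dots> \<le> 2" by (simp add: card_insert_if)
    finally show False using neg that by auto
  qed
  \<comment> \<open>Length at least 2 rules out the first edge of the path itself as a
    chord.\<close>
  define chord where "chord A \<longleftrightarrow> length A \<ge> 2 \<and> (\<exists>x Q. longest (A @ x # Q) \<and> (hd A, x) \<in> E)" for A
  have "\<exists>A. chord A"
  proof -
    have l0: "longest p0" using p0 by (simp add: longest_def)
    obtain h r where p0_eq: "p0 = h # r" using p0(1) by (cases p0) (auto simp: path_in_def)
    have hS: "h \<in> S" using p0 p0_eq by (auto simp: path_in_def)
    obtain x where x: "x \<in> S" "(h, x) \<in> E" "x \<noteq> hd r" using third[OF hS] by blast
    then have "x \<in> set p0" "x \<noteq> h" using nbrs[OF l0] p0_eq irrefl by auto
    then obtain a r' where r: "r = a # r'" "x \<in> set r'"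
      using p0_eq x by (cases r) auto
    then obtain B Q where "r' = B @ x # Q" by (meson split_list)
    then have "chord (h # a # B)"
      using l0 x r p0_eq by (auto simp: chord_def)
    then show ?thesis ..
  qed
  \<comment> \<open>By minimality the ends of \<open>A\<close> have no further neighbours in \<open>A\<close>, so each has one beyond \<open>x\<close>.\<close>
  then obtain A where A: "chord A" "\<And>A'. chord A' \<Longrightarrow> length A \<le> length A'"
    using ex_has_least_nat[of chord _ length] by blast
  then obtain x Q where xQ: "longest (A @ x # Q)" "(hd A, x) \<in> E" and len: "length A \<ge> 2"
    by (auto simp: chord_def)
  \<comment> \<open>Stated for an arbitrary \<open>A'\<close> because it is applied to
    \<open>A\<close> and to \<open>rev A\<close>.\<close>
  have outer: "\<exists>y \<in> set Q. (hd A', y) \<in> E" if A'_len: "longest (A' @ x # Q)" "length A' = length A" for A'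
  proof -
    obtain h a B where A': "A' = h # a # B"
      using A'_len(2) len by (cases A'; cases "tl A'") auto
    have "h \<in> S" using that A' by (auto simp: longest_def path_in_def)
    then obtain y where y: "y \<in> S" "(h, y) \<in> E" "y \<noteq> a" "y \<noteq> x" using third by blast
    have "hd (A' @ x # Q) = h" using A' by simp
    then have "y \<in> set (A' @ x # Q)" using nbrs[OF A'_len(1) y(1)] y(2) by simp
    moreover have "y \<notin> set B"
    proof
      assume "y \<in> set B"
      then obtain B1 B2 where "B = B1 @ y # B2" by (meson split_list)
      moreover from this have "chord (h # a # B1)"
        using that y A' by (auto simp: chord_def)
      ultimately show False using A(2) that A' by fastforce
    qed
    ultimately show ?thesis using y A' irrefl by auto
  qed
  have "A \<noteq> []" using len by auto
  have rot: "longest (rev A @ x # Q)"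
    using xQ rotate_simple_path[of A x Q] \<open>A \<noteq> []\<close> by (auto simp: longest_def path_in_def)
  have sp: "simple_path_list E (A @ x # Q)" "simple_path_list E (rev A @ x # Q)"
    using xQ rot by (auto simp: longest_def path_in_def)
  have hl: "hd (rev A) = last A" "last (rev A) = hd A"
    using \<open>A \<noteq> []\<close> by (auto simp: hd_rev last_rev)
  obtain y where y: "y \<in> set Q" "(hd A, y) \<in> E" using outer[OF xQ(1)] by blast
  obtain z where z: "z \<in> set Q" "(last A, z) \<in> E" using outer[OF rot] hl by auto
  obtain Q1 Q2 where Q: "Q = Q1 @ y # Q2" using y by (meson split_list)
  \<comment> \<open>If \<open>z\<close> comes before \<open>y\<close>, the rotated path is used, on
    which the two ends of \<open>A\<close> exchange their roles.\<close>
  consider "z = y" | "z \<in> set Q2" | "z \<in> set Q1" using z Q by auto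
  then show False
  proof cases
    case 1
    then show False using no_parallel_path_chords[of A x Q1 y Q2] sp len xQ y z Q by simp
  next
    case 2
    then obtain R1 R2 where "Q2 = R1 @ z # R2" by (meson split_list)
    then show False using no_crossing_path_chords[of A x Q1 y R1 z R2] sp len y z Q by simp
  next
    case 3
    then obtain R1 R2 where "Q1 = R1 @ z # R2" by (meson split_list)
    then show False using no_crossing_path_chords[of "rev A" x R1 z R2 y Q2] sp len y z Q hl by simp
  qed
qed

end

section \<open>Semi-proper orientations of 2-degenerate graphs\<close>

lemma in_weight_eq: "in_weight D w v = (\<Sum>e | e \<in> parcs D \<and> snd e = v. w e)"
  by (simp add: in_weight_def in_arcs_def)

text \<open>Three candidates 2, 3, 4 face at most two forbidden values. They start at 2 so that each
  can be split into two positive weights. For empty \<open>N\<close> the sum is 0 and nothing is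
  forbidden.\<close>

lemma exists_colour_and_weights:
  fixes c :: "'a \<Rightarrow> nat"
  assumes "finite N" "card N \<le> 2"
  shows "\<exists>w. (\<forall>u \<in> N. 0 < w u) \<and> sum w N \<le> 4 \<and> sum w N \<notin> c ` N"
proof -
  have "\<exists>t \<in> {2, 3, 4}. t \<notin> c ` N"
  proof (rule ccontr)
    assume "\<not> ?thesis"
    then have "card {2, 3, 4::nat} \<le> card (c ` N)" using assms by (intro card_mono) auto
    also have "\<dots> \<le> 2" using assms card_image_le[of N c] by simp
    finally show False by simp
  qed
  then obtain t where t: "t \<in> {2, 3, 4}" "t \<notin> c ` N" by blast
  have "card N = 0 \<or> card N = 1 \<or> card N = 2" using assms(2) by linarith
  then consider "N = {}" | "card N = 1" | "card N = 2" using assms(1) by auto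
  then show ?thesis
  proof cases
    case 2
    then obtain a where "N = {a}" by (auto simp: card_1_singleton_iff)
    then show ?thesis using t by (intro exI[of _ "\<lambda>_. t"]) auto
  next
    case 3
    then obtain a b where "N = {a, b}" "a \<noteq> b" by (auto simp: card_2_iff)
    then show ?thesis using t by (intro exI[of _ "\<lambda>u. if u = a then t - 1 else 1"]) auto
  qed simp
qed

text \<open>Relative to a vertex set and with in-weights written as sums over arcs, so that an
  induction can remove vertices from \<open>S\<close> while \<open>E\<close> stays fixed.\<close>

definition semi_proper_on :: "('a \<times> 'a) set \<Rightarrow> 'a set \<Rightarrow> ('a \<times> 'a) set \<Rightarrow> ('a \<times> 'a \<Rightarrow> nat) \<Rightarrow> bool" where
  "semi_proper_on E S D w \<longleftrightarrow> D \<subseteq> E \<inter> S \<times> S \<and> (\<forall>e \<in> D. 0 < w e) \<and>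
    (\<forall>u \<in> S. \<forall>v \<in> S. (u, v) \<in> E \<longrightarrow>
      ((u, v) \<in> D \<longleftrightarrow> (v, u) \<notin> D) \<and>
      (\<Sum>e | e \<in> D \<and> snd e = u. w e) \<noteq> (\<Sum>e | e \<in> D \<and> snd e = v. w e))"

text \<open>Remove a vertex \<open>v\<close> with at most two neighbours, treat the rest by
  induction and direct all edges at \<open>v\<close> towards \<open>v\<close>. No other in-weight
  changes, so only that of \<open>v\<close> has to be chosen.\<close>

lemma two_degenerate_semi_proper:
  fixes E :: "('a \<times> 'a) set"
  assumes "finite S" and sym: "\<And>u v. (u, v) \<in> E \<Longrightarrow> (v, u) \<in> E" and irrefl: "\<And>u. (u, u) \<notin> E"
    and "\<And>T. T \<subseteq> S \<Longrightarrow> T \<noteq> {} \<Longrightarrow> \<exists>v \<in> T. card {u \<in> T. (v, u) \<in> E} \<le> 2"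
  shows "\<exists>D w. semi_proper_on E S D w \<and> (\<forall>v \<in> S. (\<Sum>e | e \<in> D \<and> snd e = v. w e) \<le> 4)"
  using assms(1,4)
proof (induction S rule: finite_psubset_induct)
  case (psubset S)
  show ?case
  proof (cases "S = {}")
    case True
    then show ?thesis by (auto simp: semi_proper_on_def)
  next
    case False
    then obtain v where v: "v \<in> S" "card {u \<in> S. (v, u) \<in> E} \<le> 2"
      using psubset.prems[of S] by blast
    define N where "N = {u \<in> S. (v, u) \<in> E}"
    have "S - {v} \<subset> S" using v by blast
    moreover have "\<exists>v \<in> T. card {u \<in> T. (v, u) \<in> E} \<le> 2" if "T \<subseteq> S - {v}" "T \<noteq> {}" for T
      using psubset.prems[of T] that by blast
    ultimately obtain D w where sp: "semi_proper_on E (S - {v}) D w"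
      and le: "\<And>x. x \<in> S - {v} \<Longrightarrow> (\<Sum>e | e \<in> D \<and> snd e = x. w e) \<le> 4"
      using psubset.IH[of "S - {v}"] by blast
    have D: "D \<subseteq> E \<inter> (S - {v}) \<times> (S - {v})" and w: "\<And>e. e \<in> D \<Longrightarrow> 0 < w e"
      and ori: "\<And>x y. x \<in> S - {v} \<Longrightarrow> y \<in> S - {v} \<Longrightarrow> (x, y) \<in> E \<Longrightarrow>
        ((x, y) \<in> D \<longleftrightarrow> (y, x) \<notin> D) \<and>
        (\<Sum>e | e \<in> D \<and> snd e = x. w e) \<noteq> (\<Sum>e | e \<in> D \<and> snd e = y. w e)"
      using sp unfolding semi_proper_on_def by blast+
    have vN: "v \<notin> N" using irrefl by (simp add: N_def)
    have "finite N" "card N \<le> 2" using psubset.hyps v by (auto simp: N_def)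
    then obtain f where f: "\<And>u. u \<in> N \<Longrightarrow> 0 < f u" "sum f N \<le> 4"
        "sum f N \<notin> (\<lambda>x. \<Sum>e | e \<in> D \<and> snd e = x. w e) ` N"
      using exists_colour_and_weights[of N "\<lambda>x. \<Sum>e | e \<in> D \<and> snd e = x. w e"] by blast
    define D' where "D' = D \<union> N \<times> {v}"
    define w' where "w' e = (if snd e = v then f (fst e) else w e)" for e
    have sum_v: "(\<Sum>e | e \<in> D' \<and> snd e = v. w' e) = sum f N"
    proof -
      have "{e. e \<in> D' \<and> snd e = v} = (\<lambda>u. (u, v)) ` N"
        using D by (auto simp: D'_def)
      then show ?thesis by (simp add: sum.reindex inj_on_def w'_def)
    qed
    have sum_x: "(\<Sum>e | e \<in> D' \<and> snd e = x. w' e) = (\<Sum>e | e \<in> D \<and> snd e = x. w e)" if "x \<noteq> v" for x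
      using that by (intro sum.cong) (auto simp: D'_def w'_def)
    have N_iff: "x \<in> N" if "x \<in> S" "(v, x) \<in> E \<or> (x, v) \<in> E" for x
      using that sym[of x v] by (auto simp: N_def)
    have mem_D': "(x, y) \<in> D' \<longleftrightarrow> (x, y) \<in> D \<or> x \<in> N \<and> y = v" for x y
      by (auto simp: D'_def)
    have v_D: "(x, v) \<notin> D" "(v, x) \<notin> D" for x
      using D by blast+
    have N_E: "N \<times> {v} \<subseteq> E \<inter> S \<times> S"
      using v(1) sym unfolding N_def by blast
    have sub: "D' \<subseteq> E \<inter> S \<times> S"
      using D N_E unfolding D'_def by blast
    have ori': "(x, y) \<in> D' \<longleftrightarrow> (y, x) \<notin> D'" if "x \<in> S" "y \<in> S" "(x, y) \<in> E" for x y
    proof -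
      have "x \<noteq> y" using that irrefl by blast
      consider "x = v" | "y = v" | "x \<noteq> v" "y \<noteq> v" by blast
      then show ?thesis
      proof cases
        case 1
        then show ?thesis unfolding mem_D' using v_D vN N_iff[of y] that by blast
      next
        case 2
        then show ?thesis unfolding mem_D' using v_D vN N_iff[of x] that by blast
      next
        case 3
        then show ?thesis unfolding mem_D' using ori[of x y] that by blast
      qed
    qed
    have pos: "0 < w' e" if "e \<in> D'" for e
      using that D w[of e] f(1) by (cases e) (auto simp: D'_def w'_def)
    have le': "(\<Sum>e | e \<in> D' \<and> snd e = x. w' e) \<le> 4" if "x \<in> S" for x
      using that sum_v sum_x[of x] f le[of x] by (cases "x = v") auto
    have ne': "(\<Sum>e | e \<in> D' \<and> snd e = x. w' e) \<noteq> (\<Sum>e | e \<in> D' \<and> snd e = y. w' e)"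
      if "x \<in> S" "y \<in> S" "(x, y) \<in> E" for x y
    proof -
      have "x \<noteq> y" using that irrefl by blast
      consider "x = v" | "y = v" | "x \<noteq> v" "y \<noteq> v" by blast
      then show ?thesis
      proof cases
        case 1
        then have "sum f N \<noteq> (\<Sum>e | e \<in> D \<and> snd e = y. w e)"
          using f(3) N_iff[of y] that by blast
        then show ?thesis using 1 sum_v sum_x[of y] \<open>x \<noteq> y\<close> by simp
      next
        case 2
        then have "sum f N \<noteq> (\<Sum>e | e \<in> D \<and> snd e = x. w e)"
          using f(3) N_iff[of x] that by blast
        then show ?thesis using 2 sum_v sum_x[of x] \<open>x \<noteq> y\<close> by simp
      next
        case 3
        then show ?thesis using ori[of x y] that sum_x by simp
      qed
    qed
    have "semi_proper_on E S D' w'"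
      unfolding semi_proper_on_def using sub ori' pos ne' by simp
    then show ?thesis using le' by blast
  qed
qed

lemma two_degenerate_max_in_weight_le_4:
  assumes G: "pair_graph G"
    and deg: "\<And>T. T \<subseteq> pverts G \<Longrightarrow> T \<noteq> {} \<Longrightarrow> \<exists>v \<in> T. card {u \<in> T. (v, u) \<in> parcs G} \<le> 2"
  obtains D w where "semi_proper_orientation G D w" "max_in_weight D w \<le> 4"
proof -
  note verts = pair_graphD(1,2)[OF G] and sym = pair_graphD(4)[OF G]
  have irrefl: "(u, u) \<notin> parcs G" for u
    using pair_graphD(3)[OF G] by blast
  obtain A w where sp: "semi_proper_on (parcs G) (pverts G) A w"
      and le: "\<And>v. v \<in> pverts G \<Longrightarrow> (\<Sum>e | e \<in> A \<and> snd e = v. w e) \<le> 4"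
    using two_degenerate_semi_proper[OF pair_graph_finite_verts[OF G] sym irrefl deg] by blast
  define D where "D = \<lparr>pverts = pverts G, parcs = A\<rparr>"
  have "semi_proper_orientation G D w"
    using sp verts
    by (auto simp: semi_proper_on_def semi_proper_orientation_def orientation_def D_def in_weight_eq)
  moreover have "max_in_weight D w \<le> 4"
  proof (cases "pverts G = {}")
    case True
    then show ?thesis by (simp add: max_in_weight_def D_def Sup_nat_empty)
  next
    case False
    then show ?thesis
      unfolding max_in_weight_def using le by (intro cSUP_least) (auto simp: D_def in_weight_eq)
  qed
  ultimately show thesis using that by blast
qed

section \<open>Graphs in convex position\<close>

text \<open>The height is written as the parabola plus an excess that vanishes only at the two ends;
  comparing two chords at the same abscissa then amounts to comparing two products.\<close>

lemma parabola_chord: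
  fixes z :: complex
  assumes "z \<in> closed_segment (Complex a (a\<^sup>2)) (Complex b (b\<^sup>2))" "a < b"
  shows "a \<le> Re z" "Re z \<le> b" "Im z = (Re z)\<^sup>2 + (Re z - a) * (b - Re z)"
proof -
  obtain t where t: "0 \<le> t" "t \<le> 1" "z = (1 - t) *\<^sub>R Complex a (a\<^sup>2) + t *\<^sub>R Complex b (b\<^sup>2)"
    using assms(1) by (auto simp: in_segment)
  have Re: "Re z = a + t * (b - a)" and Im: "Im z = (1 - t) * a\<^sup>2 + t * b\<^sup>2"
    unfolding t(3) by (simp_all add: algebra_simps)
  show "a \<le> Re z" using Re t assms(2) by simp
  have "t * (b - a) \<le> b - a" using t assms(2) mult_right_mono[of t 1 "b - a"] by simp
  then show "Re z \<le> b" using Re by simp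
  show "Im z = (Re z)\<^sup>2 + (Re z - a) * (b - Re z)"
    unfolding Re Im by (simp add: algebra_simps power2_eq_square)
qed

text \<open>Intervals that do not cross are separated or nested. Separated ones share at most an
  end. If they are nested, the outer chord has the larger excess over the parabola, with equality
  only at a common end.\<close>

lemma parabola_chords_meet:
  fixes a b c d :: real
  assumes z: "z \<in> closed_segment (Complex a (a\<^sup>2)) (Complex b (b\<^sup>2))"
      "z \<in> closed_segment (Complex c (c\<^sup>2)) (Complex d (d\<^sup>2))"
    and ord: "a < b" "c < d" and ne: "\<not> (a = c \<and> b = d)"
    and nocross: "\<not> (a < c \<and> c < b \<and> b < d)" "\<not> (c < a \<and> a < d \<and> d < b)"
  shows "\<exists>x \<in> {a, b} \<inter> {c, d}. z = Complex x (x\<^sup>2)"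
proof -
  note ab = parabola_chord[OF z(1) ord(1)] and cd = parabola_chord[OF z(2) ord(2)]
  define X where "X = Re z"
  have eq: "(X - a) * (b - X) = (X - c) * (d - X)"
    using ab cd by (simp add: X_def)
  have X: "a \<le> X" "X \<le> b" "c \<le> X" "X \<le> d" using ab cd by (simp_all add: X_def)
  have nested: "X \<in> {p, q} \<inter> {r, s}"
    if "p \<le> r" "s \<le> q" "r < s" "\<not> (p = r \<and> q = s)" "r \<le> X" "X \<le> s"
      "(X - p) * (q - X) = (X - r) * (s - X)" for p q r s
  proof -
    \<comment> \<open>The difference of the two excesses, split into two nonnegative terms.\<close>
    have "(r - p) * (q - X) + (X - r) * (q - s) = 0"
      using that(7) by (simp add: algebra_simps)
    moreover have "0 \<le> (r - p) * (q - X)" "0 \<le> (X - r) * (q - s)"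
      using that by auto
    ultimately have "(r - p) * (q - X) = 0" "(X - r) * (q - s) = 0" by linarith+
    then show ?thesis using that by auto
  qed
  consider "b \<le> c" | "d \<le> a" | "a \<le> c" "d \<le> b" | "c \<le> a" "b \<le> d"
    using nocross by linarith
  then have *: "X \<in> {a, b} \<inter> {c, d}"
  proof cases
    case 3
    then show ?thesis using nested[of a c d b] X ord ne eq by simp
  next
    case 4
    then show ?thesis using nested[of c a b d] X ord ne eq by auto
  qed (use X in auto)
  have "Im z = X\<^sup>2"
    using ab(3) * X_def by auto
  then have "z = Complex X (X\<^sup>2)" by (simp add: X_def complex_eq_iff)
  with * show ?thesis by blast
qed

text \<open>The vertical ray from \<open>p\<close> downwards is connected and unbounded and misses
  \<open>S\<close>.\<close>

lemma below_parabola_outside: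
  assumes S: "\<And>z. z \<in> S \<Longrightarrow> (Re z)\<^sup>2 \<le> Im z" and p: "Im p < (Re p)\<^sup>2"
  shows "p \<in> outside S"
proof -
  define H where "H = {z. Re z = Re p \<and> Im z \<le> Im p}"
  have "H = {z. Re z \<le> Re p} \<inter> {z. Re p \<le> Re z} \<inter> {z. Im z \<le> Im p}" by (auto simp: H_def)
  then have "convex H"
    using convex_halfspace_Re_le convex_halfspace_Re_ge convex_halfspace_Im_le
    by (simp add: convex_Int)
  moreover have "H \<subseteq> - S"
  proof
    fix z assume "z \<in> H"
    then have "Im z < (Re z)\<^sup>2" using p by (auto simp: H_def)
    then show "z \<in> - S" using S[of z] by auto
  qed
  ultimately have sub: "H \<subseteq> connected_component_set (- S) p"
    by (intro connected_component_maximal) (auto simp: H_def convex_connected)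
  have "\<not> bounded H"
  proof
    assume "bounded H"
    then obtain B where B: "\<And>z. z \<in> H \<Longrightarrow> cmod z \<le> B" by (auto simp: bounded_iff)
    define y where "y = Im p - \<bar>Im p\<bar> - \<bar>B\<bar> - 1"
    have "Complex (Re p) y \<in> H" by (simp add: H_def y_def)
    then have "\<bar>y\<bar> \<le> B" using B abs_Im_le_cmod[of "Complex (Re p) y"] by fastforce
    then show False by (simp add: y_def)
  qed
  then have "\<not> bounded (connected_component_set (- S) p)"
    using sub bounded_subset by blast
  moreover have "p \<notin> S" using S[of p] p by auto
  ultimately show ?thesis by (simp add: outside_def)
qed

text \<open>Vertices go onto the parabola \<open>y = x^2\<close> and edges become straight chords.
  The drawing lies on or above the parabola, so the points just below a vertex belong to the outer
  face.\<close>

lemma noncrossing_outerplanar: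
  fixes G :: "nat pair_pre_digraph"
  assumes G: "pair_graph G"
    and nocross: "\<And>a b c d. (a, b) \<in> parcs G \<Longrightarrow> (c, d) \<in> parcs G \<Longrightarrow> \<not> (a < c \<and> c < b \<and> b < d)"
  shows "outerplanar G"
proof -
  note verts = pair_graphD(1,2)[OF G] and irrefl = pair_graphD(3)[OF G] and sym = pair_graphD(4)[OF G]
  define pos :: "nat \<Rightarrow> complex" where "pos n = Complex (real n) ((real n)\<^sup>2)" for n
  define \<gamma> where "\<gamma> = (\<lambda>(u, v). linepath (pos u) (pos v))"
  have pos_eq [simp]: "pos u = pos v \<longleftrightarrow> u = v" for u v by (simp add: pos_def)
  have im [simp]: "path_image (\<gamma> (u, v)) = closed_segment (pos u) (pos v)" for u v
    by (simp add: \<gamma>_def)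
  have vertex_on: "w = u \<or> w = v" if "pos w \<in> closed_segment (pos u) (pos v)" "u < v" for u v w
    using parabola_chord(3)[of "pos w" u v] that by (auto simp: pos_def)
  have ordered: "closed_segment (pos a) (pos b) \<inter> closed_segment (pos c) (pos d) \<subseteq> pos ` ({a, b} \<inter> {c, d})"
    if "(a, b) \<in> parcs G" "(c, d) \<in> parcs G" "{a, b} \<noteq> {c, d}" "a < b" "c < d" for a b c d
  proof
    fix z assume z: "z \<in> closed_segment (pos a) (pos b) \<inter> closed_segment (pos c) (pos d)"
    have "\<exists>x \<in> {real a, real b} \<inter> {real c, real d}. z = Complex x (x\<^sup>2)"
      using z that nocross[of a b c d] nocross[of c d a b]
      by (intro parabola_chords_meet) (auto simp: pos_def)
    then show "z \<in> pos ` ({a, b} \<inter> {c, d})"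
      by (auto simp: pos_def)
  qed
  \<comment> \<open>Both arcs of an edge have the same segment, so the one from the smaller to the
    larger vertex may be taken.\<close>
  have increasing: "\<exists>a b. (a, b) \<in> parcs G \<and> a < b \<and> {a, b} = {u, v} \<and>
      closed_segment (pos a) (pos b) = closed_segment (pos u) (pos v)" if "(u, v) \<in> parcs G" for u v
  proof (cases "u < v")
    case False
    then show ?thesis
      using that sym[OF that] irrefl[OF that]
      by (intro exI[of _ v] exI[of _ u]) (auto simp: closed_segment_commute)
  qed (use that in blast)
  have "planar_embedding G pos \<gamma>"
    unfolding planar_embedding_def
  proof (intro conjI ballI, goal_cases)
    case 1
    show ?case by (simp add: inj_on_def)
  next
    case (2 e)
    obtain u v where e: "e = (u, v)" by (cases e)
    with 2 have uv: "(u, v) \<in> parcs G" by simp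
    have "w = u \<or> w = v" if "pos w \<in> closed_segment (pos u) (pos v)" for w
      using vertex_on[of w u v] vertex_on[of w v u] that irrefl[OF uv]
      by (cases "u < v") (auto simp: closed_segment_commute)
    then show ?case
      using irrefl[OF uv] verts[OF uv] by (auto simp: e) (auto simp: \<gamma>_def arc_linepath)
  next
    case (3 e)
    obtain u v where e: "e = (u, v)" by (cases e)
    show ?case
      unfolding e prod.case
    proof (intro ballI)
      fix e' assume "e' \<in> parcs G"
      obtain x y where e': "e' = (x, y)" by (cases e')
      have E: "(u, v) \<in> parcs G" "(x, y) \<in> parcs G"
        using 3 \<open>e' \<in> parcs G\<close> e e' by auto
      have "closed_segment (pos u) (pos v) \<inter> closed_segment (pos x) (pos y) \<subseteq> pos ` ({u, v} \<inter> {x, y})"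
        if "{u, v} \<noteq> {x, y}"
      proof -
        obtain a b c d where "(a, b) \<in> parcs G" "a < b" "(c, d) \<in> parcs G" "c < d"
          and eqs: "{a, b} = {u, v}" "closed_segment (pos a) (pos b) = closed_segment (pos u) (pos v)"
            "{c, d} = {x, y}" "closed_segment (pos c) (pos d) = closed_segment (pos x) (pos y)"
          using increasing[OF E(1)] increasing[OF E(2)] by blast
        then show ?thesis using ordered[of a b c d] that unfolding eqs by blast
      qed
      then show "case e' of (x, y) \<Rightarrow> {u, v} \<noteq> {x, y} \<longrightarrow>
          path_image (\<gamma> (u, v)) \<inter> path_image (\<gamma> (x, y)) \<subseteq> pos ` ({u, v} \<inter> {x, y})"
        by (simp add: e')
    qed
  qed
  moreover have "pos u \<in> frontier (outside (drawing G pos \<gamma>))" if u: "u \<in> pverts G" for u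
  proof -
    have above: "(Re z)\<^sup>2 \<le> Im z" if "z \<in> drawing G pos \<gamma>" for z
    proof -
      have less: "(Re z)\<^sup>2 \<le> Im z" if "z \<in> closed_segment (pos a) (pos b)" "a < b" for a b
        using parabola_chord[of z "real a" "real b"] that by (simp add: pos_def)
      have "(Re z)\<^sup>2 \<le> Im z" if "z \<in> closed_segment (pos a) (pos b)" "a \<noteq> b" for a b
        using that less[of a b] less[of b a] by (auto simp: closed_segment_commute neq_iff)
      with that irrefl show ?thesis by (auto simp: drawing_def pos_def)
    qed
    have "pos u \<in> closure (outside (drawing G pos \<gamma>))"
    proof (unfold closure_approachable, intro allI impI)
      fix e :: real assume "e > 0"
      define p where "p = pos u - Complex 0 (e / 2)"
      have "p \<in> outside (drawing G pos \<gamma>)"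
        using \<open>e > 0\<close> above by (intro below_parabola_outside) (auto simp: p_def pos_def)
      moreover have "dist p (pos u) < e"
        using \<open>e > 0\<close> by (simp add: p_def dist_norm norm_complex_def)
      ultimately show "\<exists>y\<in>outside (drawing G pos \<gamma>). dist y (pos u) < e" by blast
    qed
    moreover have "pos u \<in> drawing G pos \<gamma>" using u by (simp add: drawing_def)
    then have "pos u \<notin> interior (outside (drawing G pos \<gamma>))"
      using interior_subset outside_no_overlap by blast
    ultimately show ?thesis by (simp add: frontier_def)
  qed
  ultimately show ?thesis unfolding outerplanar_def by blast
qed

section \<open>A graph without semi-proper orientations of maximum 3\<close>

text \<open>The iterated gluing of triangles in coordinates: edges are dyadic intervals, and the
  midpoint of an interval is the apex of the triangle glued onto it. The initial edge joins 0 and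
  \<open>2 ^ n\<close>.\<close>

definition dyadic_graph :: "nat \<Rightarrow> nat pair_pre_digraph" where
  "dyadic_graph n = \<lparr>pverts = {..2 ^ n},
     parcs = {(x, y). x \<le> 2 ^ n \<and> y \<le> 2 ^ n \<and>
       (\<exists>i. 2 ^ i dvd x \<and> y = x + 2 ^ i \<or> 2 ^ i dvd y \<and> x = y + 2 ^ i)}\<rparr>"

lemma pair_graph_dyadic_graph: "pair_graph (dyadic_graph n)"
proof
  show "finite (parcs (dyadic_graph n))"
    by (rule finite_subset[of _ "{..2 ^ n} \<times> {..2 ^ n}"]) (auto simp: dyadic_graph_def)
  show "symmetric (with_proj (dyadic_graph n))"
    by (auto simp: symmetric_def sym_def dyadic_graph_def)
qed (auto simp: dyadic_graph_def)

lemma no_multiple_between: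
  fixes m a c :: nat
  assumes "m dvd a" "m dvd c" "a < c" "c < a + m"
  shows False
proof -
  have "m dvd c - a" using assms by simp
  then have "m \<le> c - a" using assms by (intro dvd_imp_le) auto
  then show False using assms by linarith
qed

text \<open>If two dyadic intervals crossed, an end of the longer one would lie strictly inside the
  shorter one, although it is a multiple of the shorter length.\<close>

lemma dyadic_graph_noncrossing:
  assumes "(a, b) \<in> parcs (dyadic_graph n)" "(c, d) \<in> parcs (dyadic_graph n)"
  shows "\<not> (a < c \<and> c < b \<and> b < d)"
proof
  assume ord: "a < c \<and> c < b \<and> b < d"
  then obtain i j where ij: "2 ^ i dvd a" "b = a + 2 ^ i" "2 ^ j dvd c" "d = c + 2 ^ j"
    using assms by (auto simp: dyadic_graph_def)
  show False
  proof (cases "i \<le> j")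
    case True
    then have "2 ^ i dvd c" using ij(3) dvd_trans[OF le_imp_power_dvd] by blast
    then show False using no_multiple_between[OF ij(1)] ij ord by blast
  next
    case False
    then have "(2::nat) ^ j dvd 2 ^ i" by (simp add: le_imp_power_dvd)
    then have "2 ^ j dvd b" using ij(1,2) dvd_trans by (metis dvd_add)
    then show False using no_multiple_between[OF ij(3)] ij ord by blast
  qed
qed

text \<open>
  Here \<open>c\<close> stands for the in-weight and \<open>F i x\<close> for the number of arcs into \<open>x\<close> or \<open>x + 2 ^ i\<close> from
  vertices strictly between them.
\<close>

lemma dyadic_flow_contradiction:
  fixes c :: "nat \<Rightarrow> nat" and F :: "nat \<Rightarrow> nat \<Rightarrow> nat"
  assumes F_Suc: "\<And>i x. 2 ^ Suc i dvd x \<Longrightarrow> x + 2 ^ Suc i \<le> 32 \<Longrightarrow>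
      F i x + F i (x + 2 ^ i) + 2 \<le> F (Suc i) x + c (x + 2 ^ i)"
    and F_le: "\<And>i x. 2 ^ i dvd x \<Longrightarrow> x + 2 ^ i \<le> 32 \<Longrightarrow> F i x + 1 \<le> c x + c (x + 2 ^ i)"
    and neq: "\<And>i x. 2 ^ i dvd x \<Longrightarrow> x + 2 ^ i \<le> 32 \<Longrightarrow> c x \<noteq> c (x + 2 ^ i)"
    and le3: "\<And>x. x \<le> 32 \<Longrightarrow> c x \<le> 3"
  shows False
proof -
  \<comment> \<open>\<open>f\<close> is a table of lower bounds on \<open>F i\<close>, indexed by
    the in-weights of the two ends.\<close>
  define bound where "bound i f \<longleftrightarrow>
    (\<forall>x. 2 ^ i dvd x \<longrightarrow> x + 2 ^ i \<le> 32 \<longrightarrow> f (c x) (c (x + 2 ^ i)) \<le> F i x)"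
    for i and f :: "nat \<Rightarrow> nat \<Rightarrow> nat"
  \<comment> \<open>One level of gluing, with \<open>m\<close> the in-weight of the apex. Truncated
    subtraction is harmless in a lower bound on a natural number.\<close>
  have step: "bound (Suc i) g" if f: "bound i f"
    and g: "\<And>a b m. a \<in> {0,1,2,3} \<Longrightarrow> b \<in> {0,1,2,3} \<Longrightarrow> m \<in> {0,1,2,3} \<Longrightarrow>
      a \<noteq> b \<Longrightarrow> a \<noteq> m \<Longrightarrow> b \<noteq> m \<Longrightarrow> f a m + 1 \<le> a + m \<Longrightarrow> f m b + 1 \<le> m + b \<Longrightarrow>
      g a b \<le> f a m + f m b + 2 - m" for i f g
    unfolding bound_def
  proof (intro allI impI)
    fix x assume x: "2 ^ Suc i dvd x" "x + 2 ^ Suc i \<le> (32::nat)"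
    have dvd: "2 ^ i dvd x" using x(1) by (metis dvd_trans le_SucI le_imp_power_dvd order_refl)
    then have dvd': "2 ^ i dvd x + 2 ^ i" by simp
    have *: "x + 2 ^ i + 2 ^ i = x + 2 ^ Suc i" by simp
    have le: "x + 2 ^ i \<le> 32" "x + 2 ^ i + 2 ^ i \<le> 32" using x by simp_all
    have F1: "f (c x) (c (x + 2 ^ i)) \<le> F i x"
      by (rule f[unfolded bound_def, rule_format, OF dvd le(1)])
    have F2: "f (c (x + 2 ^ i)) (c (x + 2 ^ Suc i)) \<le> F i (x + 2 ^ i)"
      using f[unfolded bound_def, rule_format, OF dvd' le(2)] unfolding * .
    have mem: "c y \<in> {0,1,2,3}" if "y \<le> 32" for y
      using le3[OF that] by auto
    have "g (c x) (c (x + 2 ^ Suc i)) \<le>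
        f (c x) (c (x + 2 ^ i)) + f (c (x + 2 ^ i)) (c (x + 2 ^ Suc i)) + 2 - c (x + 2 ^ i)"
    proof (rule g)
      show "c x \<noteq> c (x + 2 ^ Suc i)" by (rule neq[OF x])
      show "c x \<noteq> c (x + 2 ^ i)" by (rule neq[OF dvd le(1)])
      show "c (x + 2 ^ Suc i) \<noteq> c (x + 2 ^ i)" using neq[OF dvd' le(2)] unfolding * by (rule not_sym)
      show "f (c x) (c (x + 2 ^ i)) + 1 \<le> c x + c (x + 2 ^ i)"
        using F1 F_le[OF dvd le(1)] by linarith
      show "f (c (x + 2 ^ i)) (c (x + 2 ^ Suc i)) + 1 \<le> c (x + 2 ^ i) + c (x + 2 ^ Suc i)"
        using F2 F_le[OF dvd' le(2)] unfolding * by linarith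
      show "c x \<in> {0,1,2,3}" "c (x + 2 ^ Suc i) \<in> {0,1,2,3}" "c (x + 2 ^ i) \<in> {0,1,2,3}"
        by (rule mem; use x le in simp)+
    qed
    then show "g (c x) (c (x + 2 ^ Suc i)) \<le> F (Suc i) x"
      using F1 F2 F_Suc[OF x] by linarith
  qed
  \<comment> \<open>The tables are lower bounds on the minima over all apex values in the recursion \<open>F_Suc\<close>, where
    apex values violating \<open>F_le\<close> are discarded. The last one contradicts \<open>F_le\<close>.\<close>
  have "bound 0 (\<lambda>_ _. 0)" by (simp add: bound_def)
  then have "bound (Suc 0) (\<lambda>a b. if a + b = 5 then 1 else 0)"
    by (rule step) (elim insertE emptyE; simp)
  then have "bound (Suc (Suc 0)) (\<lambda>a b. if a = 3 \<or> b = 3 then 1 else 0)"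
    by (rule step) (elim insertE emptyE; simp)
  then have "bound (Suc (Suc (Suc 0))) (\<lambda>a b. if a + b = 1 then 0 else if a + b = 5 then 2 else 1)"
    by (rule step) (elim insertE emptyE; simp)
  then have "bound (Suc (Suc (Suc (Suc 0)))) (\<lambda>a b. if a + b = 1 then 1 else if a + b < 4 then 2 else 3)"
    by (rule step) (elim insertE emptyE; simp)
  then have "bound (Suc (Suc (Suc (Suc (Suc 0))))) (\<lambda>a b. a + b)"
    by (rule step) (elim insertE emptyE; simp)
  then have "c 0 + c 32 \<le> F 5 0"
    unfolding bound_def by (auto simp: numeral_eq_Suc)
  moreover have "F 5 0 + 1 \<le> c 0 + c 32"
    using F_le[of 5 0] by simp
  ultimately show False by simp
qed

text \<open>Every weight is at least 1, so the in-weight is at least the number of entering arcs.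
  The hypothesis \<open>2 ^ i \<le> x\<close> keeps truncated subtraction from identifying different
  tails \<open>x - 2 ^ i\<close>.\<close>

lemma dyadic_in_arcs_le:
  fixes D :: "nat pair_pre_digraph"
  assumes fin: "finite (parcs D)" and pos: "\<And>e. e \<in> parcs D \<Longrightarrow> 0 < w e"
    and x: "\<And>i. i < l \<Longrightarrow> 2 ^ i \<le> x"
  shows "(\<Sum>i<k. of_bool ((x + 2 ^ i, x) \<in> parcs D)) + (\<Sum>i<l. of_bool ((x - 2 ^ i, x) \<in> parcs D))
    \<le> in_weight D w x"
proof -
  define I where "I = {i. i < k \<and> (x + 2 ^ i, x) \<in> parcs D}"
  define J where "J = {i. i < l \<and> (x - 2 ^ i, x) \<in> parcs D}"
  let ?f = "\<lambda>i::nat. (x + 2 ^ i, x)" and ?g = "\<lambda>i::nat. (x - 2 ^ i, x)"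
  have fIJ: "finite I" "finite J" by (auto simp: I_def J_def)
  have "inj_on ?f I" by (simp add: inj_on_def)
  moreover have "inj_on ?g J"
  proof (rule inj_onI)
    fix i j assume "i \<in> J" "j \<in> J" "?g i = ?g j"
    then have "2 ^ i \<le> x" "2 ^ j \<le> x" "x - 2 ^ i = x - 2 ^ j"
      using x by (auto simp: J_def)
    then have "(2::nat) ^ i = 2 ^ j" by linarith
    then show "i = j" by simp
  qed
  moreover have "?f ` I \<inter> ?g ` J = {}"
  proof -
    have "x + 2 ^ i \<noteq> x - 2 ^ j" for i j :: nat
    proof -
      have "x < x + 2 ^ i" by simp
      then show ?thesis by linarith
    qed
    then show ?thesis by auto
  qed
  ultimately have "card I + card J = card (?f ` I \<union> ?g ` J)"
    using fIJ by (simp add: card_image card_Un_disjoint)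
  also have "\<dots> = (\<Sum>e \<in> ?f ` I \<union> ?g ` J. 1)" by simp
  also have "\<dots> \<le> (\<Sum>e \<in> ?f ` I \<union> ?g ` J. w e)"
    using pos by (intro sum_mono) (auto simp: I_def J_def Suc_le_eq)
  also have "\<dots> \<le> in_weight D w x"
    unfolding in_weight_eq using fin by (intro sum_mono2) (auto simp: I_def J_def)
  finally show ?thesis
    by (simp add: I_def J_def of_bool_def sum.If_cases lessThan_def Collect_conj_eq)
qed

lemma dyadic_graph_in_weight_gt_3:
  assumes sp: "semi_proper_orientation (dyadic_graph 5) D w"
  shows "\<exists>v \<le> 32. 3 < in_weight D w v"
proof (rule ccontr)
  assume "\<not> ?thesis"
  then have le3: "in_weight D w v \<le> 3" if "v \<le> 32" for v
    using that by (meson not_le)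
  let ?E = "parcs (dyadic_graph 5)" and ?A = "parcs D"
  have sub: "?A \<subseteq> ?E" and ori: "\<And>u v. (u, v) \<in> ?E \<Longrightarrow> (u, v) \<in> ?A \<longleftrightarrow> (v, u) \<notin> ?A"
    and pos: "\<And>e. e \<in> ?A \<Longrightarrow> 0 < w e"
    and neq: "\<And>u v. (u, v) \<in> ?E \<Longrightarrow> in_weight D w u \<noteq> in_weight D w v"
    using sp unfolding semi_proper_orientation_def orientation_def by blast+
  have "finite ?E"
    by (rule finite_subset[of _ "{..32} \<times> {..32}"]) (auto simp: dyadic_graph_def)
  then have fin: "finite ?A" using sub finite_subset by blast
  have edge: "(x, x + 2 ^ i) \<in> ?E" if "2 ^ i dvd x" "x + 2 ^ i \<le> 32" for i x
    using that by (auto simp: dyadic_graph_def)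
  \<comment> \<open>Arcs of length less than \<open>2 ^ i\<close> that enter \<open>x\<close> from
    larger vertices; \<open>down\<close> counts those from smaller ones.\<close>
  define up where "up i x = (\<Sum>j<i. of_bool ((x + 2 ^ j, x) \<in> ?A) :: nat)" for i x
  define down where "down i x = (\<Sum>j<i. of_bool ((x - 2 ^ j, x) \<in> ?A) :: nat)" for i x
  define F where "F i x = up i x + down i (x + 2 ^ i)" for i x
  note in_le = dyadic_in_arcs_le[where D = D and w = w, OF fin pos]
  \<comment> \<open>The largest power subtracted in \<open>down l x\<close> is
    \<open>2 ^ (l - 1)\<close>, so it is enough to bound this one by \<open>x\<close>.\<close>
  have up_down_le: "up k x + down l x \<le> in_weight D w x" if "l = 0 \<or> 2 ^ (l - 1) \<le> x" for k l x
  proof -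
    have "2 ^ i \<le> x" if "i < l" for i
    proof -
      have "(2::nat) ^ i \<le> 2 ^ (l - 1)" using that by (intro power_increasing) auto
      also have "2 ^ (l - 1) \<le> x" using \<open>l = 0 \<or> 2 ^ (l - 1) \<le> x\<close> that by auto
      finally show ?thesis .
    qed
    then show ?thesis using in_le[where k = k and l = l and x = x] by (simp add: up_def down_def)
  qed
  have up_Suc: "up (Suc i) x = up i x + of_bool ((x + 2 ^ i, x) \<in> ?A)" for i x
    by (simp add: up_def)
  have down_Suc: "down (Suc i) x = down i x + of_bool ((x - 2 ^ i, x) \<in> ?A)" for i x
    by (simp add: down_def)
  have one: "of_bool ((x + 2 ^ i, x) \<in> ?A) + of_bool ((x, x + 2 ^ i) \<in> ?A) = (1::nat)"
    if "2 ^ i dvd x" "x + 2 ^ i \<le> 32" for i x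
    using ori[OF edge[OF that]] by auto
  show False
  proof (rule dyadic_flow_contradiction[where F = F and c = "in_weight D w"])
    fix i x assume x: "2 ^ Suc i dvd x" "x + 2 ^ Suc i \<le> (32::nat)"
    define m n where "m = x + 2 ^ i" and "n = m + 2 ^ i"
    then have eqs: "x + 2 ^ i = m" "m + 2 ^ i = n" "x + 2 ^ Suc i = n" "m - 2 ^ i = x" "n - 2 ^ i = m"
      by simp_all
    have dvd: "2 ^ i dvd x" using x(1) by (metis dvd_trans le_SucI le_imp_power_dvd order_refl)
    then have dvd': "2 ^ i dvd m" by (simp add: m_def)
    have le: "m \<le> 32" "n \<le> 32" using x(2) unfolding eqs by (simp_all add: n_def)
    \<comment> \<open>Each of the two edges at the apex \<open>m\<close> is directed either into
      \<open>m\<close>, where the in-weight of \<open>m\<close> pays for it, or into an outer end,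
      where \<open>F (Suc i) x\<close> counts it. This gives the 2 in the recursion.\<close>
    have 1: "of_bool ((m, x) \<in> ?A) + of_bool ((x, m) \<in> ?A) = (1::nat)"
      using one[OF dvd] le(1) unfolding eqs by blast
    have 2: "of_bool ((n, m) \<in> ?A) + of_bool ((m, n) \<in> ?A) = (1::nat)"
      using one[OF dvd'] le(2) unfolding eqs by blast
    have "up (Suc i) m + down (Suc i) m \<le> in_weight D w m"
      by (rule up_down_le) (simp add: m_def)
    then have 3: "up i m + of_bool ((n, m) \<in> ?A) + (down i m + of_bool ((x, m) \<in> ?A)) \<le> in_weight D w m"
      unfolding up_Suc[of i] down_Suc[of i] eqs .
    have "F (Suc i) x = up i x + of_bool ((m, x) \<in> ?A) + (down i n + of_bool ((m, n) \<in> ?A))"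
      unfolding F_def up_Suc[of i] down_Suc[of i] eqs ..
    moreover have "F i x = up i x + down i m" "F i m = up i m + down i n"
      unfolding F_def eqs by (rule refl)+
    ultimately show "F i x + F i (x + 2 ^ i) + 2 \<le> F (Suc i) x + in_weight D w (x + 2 ^ i)"
      using 1 2 3 unfolding eqs by linarith
  next
    fix i x assume x: "2 ^ i dvd x" "x + 2 ^ i \<le> (32::nat)"
    \<comment> \<open>The extra 1 is the edge between the two ends: it enters one of them and is not
      counted by \<open>F i x\<close>.\<close>
    have "up (Suc i) x + down 0 x \<le> in_weight D w x"
      "up 0 (x + 2 ^ i) + down (Suc i) (x + 2 ^ i) \<le> in_weight D w (x + 2 ^ i)"
      by (rule up_down_le; simp)+
    then show "F i x + 1 \<le> in_weight D w x + in_weight D w (x + 2 ^ i)"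
      using one[OF x] by (simp add: F_def up_Suc down_Suc)
  next
    fix i x assume "2 ^ i dvd x" "x + 2 ^ i \<le> (32::nat)"
    then show "in_weight D w x \<noteq> in_weight D w (x + 2 ^ i)"
      using neq edge by blast
  qed (rule le3)
qed

section \<open>The upper bound and its tightness\<close>

lemma outerplanar_two_degenerate:
  assumes G: "pair_graph G" and out: "outerplanar G" and T: "T \<subseteq> pverts G" "T \<noteq> {}"
  shows "\<exists>v \<in> T. card {u \<in> T. (v, u) \<in> parcs G} \<le> 2"
proof -
  obtain pos \<gamma> where emb: "planar_embedding G pos \<gamma>"
    and fr: "pos ` pverts G \<subseteq> frontier (outside (drawing G pos \<gamma>))"
    using out unfolding outerplanar_def by blast
  have "finite T"
    using T(1) pair_graph_finite_verts[OF G] by (rule finite_subset)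
  then show ?thesis
    using T(2) pair_graphD(3,4)[OF G] outerplanar_no_K4[OF G emb fr] outerplanar_no_theta[OF G emb fr]
    by (intro exists_degree_le_2) blast+
qed

text \<open>Existence is recorded as well, because the value of \<open>LEAST\<close> is known to be
  attained only when some semi-proper orientation exists.\<close>

lemma outerplanar_number_le_4:
  assumes "pair_graph G" "outerplanar G"
  shows "\<exists>D w. semi_proper_orientation G D w" "semi_proper_orientation_number G \<le> 4"
proof -
  obtain D w where Dw: "semi_proper_orientation G D w" "max_in_weight D w \<le> 4"
    using two_degenerate_max_in_weight_le_4[OF assms(1) outerplanar_two_degenerate[OF assms]] by blast
  then show "\<exists>D w. semi_proper_orientation G D w" by blast
  have "semi_proper_orientation_number G \<le> max_in_weight D w"
    unfolding semi_proper_orientation_number_def using Dw(1) by (intro Least_le) blast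
  then show "semi_proper_orientation_number G \<le> 4" using Dw(2) by simp
qed

lemma semi_proper_orientation_number_attained:
  assumes "semi_proper_orientation G D w"
  obtains D' w' where "semi_proper_orientation G D' w'"
    "max_in_weight D' w' = semi_proper_orientation_number G"
proof -
  have "\<exists>D' w'. semi_proper_orientation G D' w' \<and> max_in_weight D' w' = semi_proper_orientation_number G"
    unfolding semi_proper_orientation_number_def by (rule LeastI_ex) (use assms in blast)
  then show thesis using that by blast
qed

theorem theorem3:
  shows "(\<forall>G :: 'a pair_pre_digraph. pair_graph G \<and> outerplanar G \<longrightarrow>
            semi_proper_orientation_number G \<le> 4) \<and>
         (\<exists>G :: nat pair_pre_digraph. pair_graph G \<and> outerplanar G \<and>
            semi_proper_orientation_number G = 4)"
proof
  show "\<forall>G :: 'a pair_pre_digraph. pair_graph G \<and> outerplanar G \<longrightarrow>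
      semi_proper_orientation_number G \<le> 4"
    using outerplanar_number_le_4 by blast
next
  let ?G = "dyadic_graph 5"
  have G: "pair_graph ?G" by (rule pair_graph_dyadic_graph)
  have out: "outerplanar ?G"
    by (rule noncrossing_outerplanar[OF G dyadic_graph_noncrossing])
  obtain D w where "semi_proper_orientation ?G D w"
    using outerplanar_number_le_4(1)[OF G out] by blast
  \<comment> \<open>An optimal orientation is taken, so that its vertex of in-weight above 3 bounds
    the number itself from below.\<close>
  then obtain D w where Dw: "semi_proper_orientation ?G D w"
      "max_in_weight D w = semi_proper_orientation_number ?G"
    by (rule semi_proper_orientation_number_attained)
  obtain v where v: "v \<le> 32" "3 < in_weight D w v"
    using dyadic_graph_in_weight_gt_3[OF Dw(1)] by blast
  have verts: "pverts D = {..32}"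
    using Dw(1) by (simp add: semi_proper_orientation_def orientation_def dyadic_graph_def)
  have "in_weight D w v \<le> max_in_weight D w"
    unfolding max_in_weight_def verts using v(1) by (intro cSUP_upper) auto
  then have "semi_proper_orientation_number ?G = 4"
    using v(2) Dw(2) outerplanar_number_le_4(2)[OF G out] by linarith
  then show "\<exists>G :: nat pair_pre_digraph. pair_graph G \<and> outerplanar G \<and>
      semi_proper_orientation_number G = 4"
    using G out by blast
qed

end
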